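(* Let $N\ge2$, $\omega_c>0$, $\Omega=\omega_c I\in\mathbb{R}^{N\times N}$, $\mathbb{Q}=\mathbb{L}D\mathbb{M}\in\mathbb{R}^{N\times N}$, and $$\mathcal{Q}=\begin{bmatrix}\mathbf{0}_{N\times N} & -\mathbb{Q}\\ \Omega & -\Omega\end{bmatrix}\in\mathbb{R}^{2N\times 2N}.$$ Assume that either (A) $D=I$, or (B) $D\neq I$, $D>0$ and $\mathbb{L}D\mathbb{M}=\mathbb{M}D\mathbb{L}$. Then the origin of the linear system $\dot{x}=\mathcal{Q}x$, i.e. with $x=[\mathbf{\Delta V}^T\ \mathbf{V}^T]^T$, $$\dot{\mathbf{\Delta V}}=-\mathbb{Q}\mathbf{V},\qquad \dot{\mathbf{V}}=\Omega\mathbf{\Delta V}-\Omega\mathbf{V},$$ is globally exponentially stable on $H^1\times H^1$. Furthermore, the matrix $\mathcal{Q}$ has a simple zero eigenvalue, and the rate of convergence is $\eta=-\max\mathrm{Re}(\lambda)$, where the maximum is taken over all the other eigenvalues $\lambda$ of $\mathcal{Q}$.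
   Context: $\mathcal{G}_c$ is an undirected connected graph with node set $\{1,\dots,N\}$ and edge weights $a_{ij}=a_{ji}>0$; $\mathbb{L}=k_I\mathcal{L}(\mathcal{G}_c)$ with $k_I>0$ a constant. $\mathcal{G}_{el}$ is a weakly connected directed graph with the same node set and positive edge weights; $\mathbb{M}=\mathcal{L}(\mathcal{G}_{el})$. The Laplacian of a weighted (di)graph with incidence matrix $B$ and diagonal matrix $W$ of edge weights is $\mathcal{L}=BWB^T$ (independent of edge orientations). $D=\mathrm{diag}(d_1,\dots,d_N)$ with all $d_i>0$. $H^1=\{v\in\mathbb{R}^N: \frac1N\sum_i v_i=0\}$. Definition: let $\mathcal{V}$ be a subspace of $\mathbb{R}^n$ and let $P_{\mathcal{V}}$ denote the projection on $\mathcal{V}$. The origin of $\dot x=\mathcal{A}x$, $x(t)\in\mathbb{R}^n$, is globally exponentially stable on $\mathcal{V}$ if there exist $\kappa,\eta>0$ such that $\|P_{\mathcal{V}}x(t)\|\le\kappa e^{-\eta t}\|P_{\mathcal{V}}x(0)\|$. The parameter $\eta$ in this estimate is termed rate of convergence.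
   Formalization: The rate of convergence is taken as the least upper bound of the exponents for which the estimate holds; the estimate with exactly η is claimed only when the eigenvalues with real part −η are semisimple, since it fails when such an eigenvalue has a Jordan block. *)

theory Defs
  imports
    "HOL-Analysis.Analysis"
    "HOL-Computational_Algebra.Polynomial"
    "HOL-Library.Lub_Glb"
begin

section \<open>Matrices\<close>

definition diag_matrix :: "('n \<Rightarrow> 'a::zero) \<Rightarrow> 'a^'n^'n" where
  "diag_matrix d = (\<chi> i j. if i = j then d i else 0)"

text \<open>Vectors and matrices of size \<open>m + n\<close> are indexed by the sum type, with \<open>Inl\<close> selecting
  the first block and \<open>Inr\<close> the second one.\<close>

definition stack :: "'a^'m \<Rightarrow> 'a^'n \<Rightarrow> 'a^('m + 'n)" where
  "stack u v = (\<chi> i. case i of Inl k \<Rightarrow> u $ k | Inr k \<Rightarrow> v $ k)"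

definition block_matrix ::
  "'a^'p^'m \<Rightarrow> 'a^'q^'m \<Rightarrow> 'a^'p^'n \<Rightarrow> 'a^'q^'n \<Rightarrow> 'a^('p + 'q)^('m + 'n)" where
  "block_matrix A B C D = (\<chi> i. case i of
      Inl k \<Rightarrow> stack (A $ k) (B $ k)
    | Inr k \<Rightarrow> stack (C $ k) (D $ k))"

lemma block_matrix_mult_stack:
  fixes A :: "'a::semiring_1^'p^'m" and B :: "'a^'q^'m" and C :: "'a^'p^'n" and D :: "'a^'q^'n"
  shows "block_matrix A B C D *v stack u v = stack (A *v u + B *v v) (C *v u + D *v v)"
proof -
  have "(\<Sum>j\<in>UNIV. stack a b $ j * stack u v $ j)
      = (\<Sum>j\<in>UNIV. a $ j * u $ j) + (\<Sum>j\<in>UNIV. b $ j * v $ j)" for a :: "'a^'p" and b :: "'a^'q"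
    by (simp add: stack_def UNIV_Plus_UNIV [symmetric] sum.Plus del: UNIV_Plus_UNIV)
  then show ?thesis
    by (auto simp: vec_eq_iff block_matrix_def matrix_vector_mult_def stack_def split: sum.splits)
qed

abbreviation complex_matrix :: "real^'n^'m \<Rightarrow> complex^'n^'m" where
  "complex_matrix \<equiv> map_matrix complex_of_real"

definition charpoly :: "'a::comm_ring_1^'n^'n \<Rightarrow> 'a poly" where
  "charpoly A = det (\<chi> i j. (if i = j then [:0, 1:] else 0) - [:A $ i $ j:])"

definition eigenvalues :: "real^'n^'n \<Rightarrow> complex set" where
  "eigenvalues A = {z. \<exists>v::complex^'n. v \<noteq> 0 \<and> complex_matrix A *v v = z *s v}"

definition simple_eigenvalue :: "real^'n^'n \<Rightarrow> complex \<Rightarrow> bool" where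
  "simple_eigenvalue A z \<longleftrightarrow> z \<in> eigenvalues A \<and> order z (charpoly (complex_matrix A)) = 1"

text \<open>No nontrivial Jordan block for \<open>z\<close>, i.e. geometric and algebraic multiplicity agree.\<close>

definition semisimple_eigenvalue :: "real^'n^'n \<Rightarrow> complex \<Rightarrow> bool" where
  "semisimple_eigenvalue A z \<longleftrightarrow> z \<in> eigenvalues A \<and>
     (\<forall>v::complex^'n. let B = complex_matrix A - mat z in B *v (B *v v) = 0 \<longrightarrow> B *v v = 0)"


section \<open>Graphs and Laplacians\<close>

text \<open>The node set is the finite type \<open>'n\<close>.  An undirected graph is a symmetric relation with a
  symmetric weight function; the values of a weight function off the edge set are irrelevant.\<close>

definition connected_weighted_graph :: "('n \<times> 'n) set \<Rightarrow> ('n \<Rightarrow> 'n \<Rightarrow> real) \<Rightarrow> bool" where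
  "connected_weighted_graph E a \<longleftrightarrow>
     sym E \<and> (\<forall>(i, j) \<in> E. a i j = a j i \<and> a i j > 0) \<and> (\<forall>i j. (i, j) \<in> E\<^sup>*)"

definition weakly_connected_weighted_digraph ::
  "('n \<times> 'n) set \<Rightarrow> ('n \<Rightarrow> 'n \<Rightarrow> real) \<Rightarrow> bool" where
  "weakly_connected_weighted_digraph E w \<longleftrightarrow>
     (\<forall>(i, j) \<in> E. w i j > 0) \<and> (\<forall>i j. (i, j) \<in> (E \<union> E\<inverse>)\<^sup>*)"

text \<open>An orientation picks exactly one of \<open>(i, j)\<close>, \<open>(j, i)\<close> for every undirected edge between
  distinct nodes.\<close>

definition orientation_of :: "('n \<times> 'n) set \<Rightarrow> ('n \<times> 'n) set \<Rightarrow> bool" where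
  "orientation_of F E \<longleftrightarrow> antisym F \<and> F \<union> F\<inverse> = E"

text \<open>Columns of the incidence matrix are indexed by all pairs of nodes.  Pairs that are not edges
  get a zero column, which contributes nothing to the Laplacian.\<close>

definition incidence_matrix :: "('n \<times> 'n) set \<Rightarrow> real^('n \<times> 'n)^'n" where
  "incidence_matrix E = (\<chi> k e. if e \<in> E
     then (if k = fst e then 1 else 0) - (if k = snd e then 1 else 0) else 0)"

definition laplacian :: "('n \<times> 'n) set \<Rightarrow> ('n \<Rightarrow> 'n \<Rightarrow> real) \<Rightarrow> real^'n^'n" where
  "laplacian E w = incidence_matrix E ** diag_matrix (\<lambda>(i, j). w i j)
     ** transpose (incidence_matrix E)"


section \<open>Exponential stability on a subspace\<close>

definition orth_proj :: "'a::real_inner set \<Rightarrow> 'a \<Rightarrow> 'a" where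
  "orth_proj V x = (THE y. y \<in> V \<and> (\<forall>v\<in>V. orthogonal (x - y) v))"

definition linear_ode_solution :: "real^'n^'n \<Rightarrow> (real \<Rightarrow> real^'n) \<Rightarrow> bool" where
  "linear_ode_solution A x \<longleftrightarrow>
     (\<forall>t\<ge>0. (x has_vector_derivative A *v x t) (at t within {0..}))"

definition exp_estimate :: "real^'n^'n \<Rightarrow> (real^'n) set \<Rightarrow> real \<Rightarrow> bool" where
  "exp_estimate A V \<eta> \<longleftrightarrow> (\<exists>\<kappa>>0. \<forall>x. linear_ode_solution A x \<longrightarrow>
     (\<forall>t\<ge>0. norm (orth_proj V (x t)) \<le> \<kappa> * exp (- \<eta> * t) * norm (orth_proj V (x 0))))"

definition globally_exp_stable_on :: "real^'n^'n \<Rightarrow> (real^'n) set \<Rightarrow> bool" where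
  "globally_exp_stable_on A V \<longleftrightarrow> subspace V \<and> (\<exists>\<eta>>0. exp_estimate A V \<eta>)"

text \<open>The estimate holds for every positive exponent below an admissible one, so the rate of
  convergence is the least upper bound of the admissible exponents.  It need not be admissible
  itself: a Jordan block for a dominant eigenvalue produces a factor that is polynomial in time.\<close>

definition convergence_rate :: "real^'n^'n \<Rightarrow> (real^'n) set \<Rightarrow> real \<Rightarrow> bool" where
  "convergence_rate A V \<eta> \<longleftrightarrow> isLub UNIV {\<eta>'. \<eta>' > 0 \<and> exp_estimate A V \<eta>'} \<eta>"


section \<open>Zero-average vectors\<close>

definition H1 :: "(real^'n::finite) set" where
  "H1 = {v. 1 / real CARD('n) * (\<Sum>i\<in>UNIV. v $ i) = 0}"

definition H1_times_H1 :: "(real^('n::finite + 'n)) set" where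
  "H1_times_H1 = {stack u v | u v. u \<in> H1 \<and> v \<in> H1}"

end

theory Submission
  imports Defs
begin

text \<open>In both cases there is a symmetric matrix \<open>G\<close> that is positive definite on \<open>H1\<close>, such that
  \<open>G Q\<close> is symmetric and positive definite on \<open>H1\<close> as well: \<open>G = M\<close> if \<open>D = 1\<close>, and \<open>G = 1\<close> if
  \<open>L D M = M D L\<close>.  Let \<open>\<mu> > 0\<close> be the minimum of the Rayleigh quotient of \<open>G Q\<close> against \<open>G\<close> on \<open>H1\<close>;
  it is an eigenvalue of \<open>Q\<close>.  The centred part of a solution solves the same system, and an energy
  form bounds its decay from below by the exponent \<open>\<omega> / 2 - c\<close> whenever
  \<open>c\<^sup>2 \<ge> \<omega>\<^sup>2 / 4 - \<omega> \<mu>\<close> (and \<open>c > 0\<close> or \<open>\<omega> \<mu> > \<omega>\<^sup>2 / 4\<close>).  Conversely an eigenvector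
  of the system bounds every admissible exponent, and the eigenvector of \<open>Q\<close> for \<open>\<mu>\<close> yields an eigenvalue
  whose real part is the negative of the best exponent.  The degenerate case \<open>\<omega> \<mu> = \<omega>\<^sup>2 / 4\<close>, where that
  exponent is not attained by the energy estimate, is exactly the one in which a dominant eigenvalue has a nontrivial
  Jordan block.\<close>

section \<open>Rayleigh quotients\<close>

text \<open>On the line \<open>y + t *\<^sub>R x\<close> the form equals
  \<open>2 * t * b + t^2 * q\<close>, negative for small \<open>t\<close> of sign opposite to
  \<open>b\<close> unless \<open>b = 0\<close>. So null vectors of a semidefinite form lie in its
  radical.\<close>

lemma psd_form_null:
  fixes T :: "'a::real_inner \<Rightarrow> 'a"
  assumes "linear T" "subspace V"
    and sym: "\<And>x y. x \<in> V \<Longrightarrow> y \<in> V \<Longrightarrow> x \<bullet> T y = y \<bullet> T x"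
    and nonneg: "\<And>x. x \<in> V \<Longrightarrow> 0 \<le> x \<bullet> T x"
    and y: "y \<in> V" "y \<bullet> T y = 0" and x: "x \<in> V"
  shows "x \<bullet> T y = 0"
proof (rule ccontr)
  define b q where "b = x \<bullet> T y" and "q = x \<bullet> T x"
  assume "x \<bullet> T y \<noteq> 0"
  then have b: "b \<noteq> 0" and q: "q \<ge> 0"
    using nonneg[OF x] by (auto simp: b_def q_def)
  \<comment> \<open>The minimiser is \<open>- b / q\<close>; using \<open>q + 1\<close> avoids
    division by zero and still gives a negative value.\<close>
  define t where "t = - b / (q + 1)"
  have "y + t *\<^sub>R x \<in> V"
    using assms by (simp add: subspace_add subspace_scale)
  then have "0 \<le> (y + t *\<^sub>R x) \<bullet> T (y + t *\<^sub>R x)"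
    by (rule nonneg)
  also have "\<dots> = 2 * t * b + t^2 * q"
    using y sym[OF x y(1)] \<open>linear T\<close>
    by (simp add: linear_add linear_scale inner_add_left inner_add_right b_def q_def
        power2_eq_square algebra_simps)
  also have "\<dots> = - (b^2 * (q + 2)) / (q + 1)^2"
    using q by (simp add: t_def divide_simps power2_eq_square) (simp add: algebra_simps)
  also have "\<dots> < 0"
    using b q by (simp add: divide_neg_pos)
  finally show False by simp
qed

text \<open>Compactness of the unit sphere of \<open>V\<close> yields a minimiser \<open>y\<close>.
  Then \<open>S - m G\<close> is semidefinite on \<open>V\<close> with null vector \<open>y\<close>,
  so stationarity follows from \<open>psd_form_null\<close> without differentiation.\<close>

lemma rayleigh_minimum:
  fixes S G :: "'a::euclidean_space \<Rightarrow> 'a"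
  assumes lin: "linear S" "linear G" and V: "subspace V" "V \<noteq> {0}"
    and S_sym: "\<And>x y. x \<in> V \<Longrightarrow> y \<in> V \<Longrightarrow> x \<bullet> S y = y \<bullet> S x"
    and G_sym: "\<And>x y. x \<in> V \<Longrightarrow> y \<in> V \<Longrightarrow> x \<bullet> G y = y \<bullet> G x"
    and G_pos: "\<And>x. x \<in> V \<Longrightarrow> x \<noteq> 0 \<Longrightarrow> 0 < x \<bullet> G x"
  obtains m y where "y \<in> V" "y \<noteq> 0"
    "\<And>x. x \<in> V \<Longrightarrow> m * (x \<bullet> G x) \<le> x \<bullet> S x"
    "\<And>x. x \<in> V \<Longrightarrow> x \<bullet> (S y - m *\<^sub>R G y) = 0"
proof -
  define K where "K = V \<inter> sphere 0 1"
  define f where "f x = (x \<bullet> S x) / (x \<bullet> G x)" for x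
  have unit: "x /\<^sub>R norm x \<in> K" if "x \<in> V" "x \<noteq> 0" for x
    using that V by (simp add: K_def subspace_scale)
  obtain x0 where "x0 \<in> V" "x0 \<noteq> 0"
    using V subspace_0 by blast
  then have "K \<noteq> {}"
    using unit by blast
  moreover have "compact K"
    unfolding K_def using V by (simp add: closed_Int_compact closed_subspace)
  moreover have "continuous_on K f"
    unfolding f_def
    by (intro continuous_intros linear_continuous_on linear_conv_bounded_linear[THEN iffD1] lin)
       (use G_pos in \<open>force simp: K_def\<close>)
  ultimately obtain y where y: "y \<in> K" and min: "\<And>x. x \<in> K \<Longrightarrow> f y \<le> f x"
    using continuous_attains_inf[of K f] by auto
  define m where "m = f y"
  define T where "T x = S x - m *\<^sub>R G x" for x
  have y': "y \<in> V" "y \<noteq> 0"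
    using y by (auto simp: K_def)
  have nonneg: "0 \<le> x \<bullet> T x" if "x \<in> V" for x
  proof (cases "x = 0")
    case True
    then show ?thesis using lin by (simp add: T_def linear_0)
  next
    case False
    have "m \<le> f (x /\<^sub>R norm x)"
      using min unit that False by (simp add: m_def)
    also have "\<dots> = f x"
      using lin False by (simp add: f_def linear_scale)
    finally show ?thesis
      using G_pos[OF that False] by (simp add: f_def T_def inner_diff_right pos_le_divide_eq)
  qed
  have "linear T"
    unfolding T_def using lin by (intro linear_compose_sub linear_compose_scale_right) auto
  moreover have "y \<bullet> T y = 0"
    using G_pos[OF y'] by (simp add: T_def m_def f_def inner_diff_right)
  moreover have "x \<bullet> T z = z \<bullet> T x" if "x \<in> V" "z \<in> V" for x z
    using S_sym[OF that] G_sym[OF that] by (simp add: T_def inner_diff_right)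
  ultimately have "x \<bullet> T y = 0" if "x \<in> V" for x
    using psd_form_null V nonneg y' that by blast
  with y' nonneg show thesis
    by (intro that[of y m]) (auto simp: T_def inner_diff_right)
qed

section \<open>Exponential estimates\<close>

lemma orth_proj_eqI:
  assumes "subspace V" "y \<in> V" "\<And>v. v \<in> V \<Longrightarrow> (x - y) \<bullet> v = 0"
  shows "orth_proj V x = y"
  unfolding orth_proj_def
proof (rule the_equality)
  show "y \<in> V \<and> (\<forall>v\<in>V. orthogonal (x - y) v)"
    using assms by (simp add: orthogonal_def)
next
  fix z assume z: "z \<in> V \<and> (\<forall>v\<in>V. orthogonal (x - z) v)"
  then have "z - y \<in> V"
    using assms by (simp add: subspace_diff)
  then have "(x - y) \<bullet> (z - y) = 0" "(x - z) \<bullet> (z - y) = 0"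
    using assms z by (auto simp: orthogonal_def)
  then have "(z - y) \<bullet> (z - y) = 0"
    by (simp add: inner_diff_left)
  then show "z = y" by simp
qed

lemma exp_estimate_mono:
  assumes "exp_estimate A V \<eta>" "\<eta>' \<le> \<eta>"
  shows "exp_estimate A V \<eta>'"
proof -
  obtain \<kappa> where \<kappa>: "\<kappa> > 0" "\<forall>x. linear_ode_solution A x \<longrightarrow> (\<forall>t\<ge>0.
      norm (orth_proj V (x t)) \<le> \<kappa> * exp (- \<eta> * t) * norm (orth_proj V (x 0)))"
    using assms(1) unfolding exp_estimate_def by blast
  have "norm (orth_proj V (x t)) \<le> \<kappa> * exp (- \<eta>' * t) * norm (orth_proj V (x 0))"
    if "linear_ode_solution A x" "t \<ge> 0" for x t
  proof -
    have "norm (orth_proj V (x t)) \<le> \<kappa> * exp (- \<eta> * t) * norm (orth_proj V (x 0))"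
      using \<kappa>(2) that by blast
    also have "\<dots> \<le> \<kappa> * exp (- \<eta>' * t) * norm (orth_proj V (x 0))"
      using \<kappa>(1) assms(2) that by (intro mult_right_mono mult_left_mono) (auto simp: mult_right_mono)
    finally show ?thesis .
  qed
  with \<kappa>(1) show ?thesis
    unfolding exp_estimate_def by blast
qed

text \<open>As \<open>P\<close> commutes with \<open>A\<close>, the projected solution solves the
  same system, and \<open>decay\<close> keeps
  \<open>exp (2 * \<eta> * t) * B (P (x t)) (P (x t))\<close> from growing. Coercivity and
  boundedness of \<open>B\<close> turn this into a norm bound with constant
  \<open>sqrt (K / \<alpha>)\<close>.\<close>

lemma exp_estimate_lyapunov:
  fixes A :: "real^'k^'k" and B :: "real^'k \<Rightarrow> real^'k \<Rightarrow> real"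
  assumes B: "bounded_bilinear B" and sym: "\<And>x y. B x y = B y x"
    and P: "linear P" "\<And>x. P (A *v x) = A *v P x" "\<And>x. orth_proj V x = P x"
    and lower: "\<alpha> > 0" "\<And>x. \<alpha> * (norm (P x))\<^sup>2 \<le> B (P x) (P x)"
    and decay: "\<And>x. B (P x) (A *v P x) \<le> - \<eta> * B (P x) (P x)"
  shows "exp_estimate A V \<eta>"
proof -
  obtain K where K: "K > 0" "\<And>x y. norm (B x y) \<le> norm x * norm y * K"
    using bounded_bilinear.pos_bounded[OF B] by auto
  have estimate: "norm (P (x t)) \<le> sqrt (K / \<alpha>) * exp (- \<eta> * t) * norm (P (x 0))"
    if x: "linear_ode_solution A x" and t: "t \<ge> 0" for x t
  proof -
    define y where "y s = P (x s)" for s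
    define f where "f s = exp (2 * \<eta> * s) * B (y s) (y s)" for s
    have y': "(y has_vector_derivative A *v y s) (at s within {0..})" if "s \<ge> 0" for s
    proof -
      have "bounded_linear P"
        using P(1) by (simp add: linear_conv_bounded_linear)
      moreover have "(x has_vector_derivative A *v x s) (at s within {0..})"
        using x that by (simp add: linear_ode_solution_def)
      ultimately have "((\<lambda>s. P (x s)) has_vector_derivative P (A *v x s)) (at s within {0..})"
        by (rule bounded_linear.has_vector_derivative)
      then show ?thesis by (simp add: y_def[abs_def] P(2))
    qed
    have f': "(f has_real_derivative exp (2 * \<eta> * s) * (2 * (B (y s) (A *v y s) + \<eta> * B (y s) (y s))))
        (at s within {0..})" if "s \<ge> 0" for s
    proof -
      have "((\<lambda>s. B (y s) (y s)) has_vector_derivative B (y s) (A *v y s) + B (A *v y s) (y s))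
          (at s within {0..})"
        by (rule bounded_bilinear.has_vector_derivative[OF B y' y']) (fact that)+
      then have B': "((\<lambda>s. B (y s) (y s)) has_real_derivative 2 * B (y s) (A *v y s)) (at s within {0..})"
        by (simp add: has_real_derivative_iff_has_vector_derivative sym[of "A *v y s"])
      have "((\<lambda>s. exp (2 * \<eta> * s)) has_real_derivative 2 * \<eta> * exp (2 * \<eta> * s)) (at s within {0..})"
        by (auto intro!: derivative_eq_intros)
      from DERIV_mult[OF this B'] show ?thesis
        by (simp add: f_def[abs_def] algebra_simps)
    qed
    have "f t \<le> f 0"
    proof (rule DERIV_nonpos_imp_decreasing_open[OF t])
      fix s assume s: "0 < s" "s < t"
      have "at s within {0..} = at s"
        using s by (intro at_within_interior) simp
      then have "(f has_real_derivative exp (2 * \<eta> * s) * (2 * (B (y s) (A *v y s) + \<eta> * B (y s) (y s)))) (at s)"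
        using f'[of s] s by simp
      moreover have "exp (2 * \<eta> * s) * (2 * (B (y s) (A *v y s) + \<eta> * B (y s) (y s))) \<le> 0"
        using decay[of "x s"] by (intro mult_nonneg_nonpos) (auto simp: y_def)
      ultimately show "\<exists>d. DERIV f s :> d \<and> d \<le> 0"
        by blast
    next
      show "continuous_on {0..t} f"
        by (rule continuous_on_subset[of "{0..}"])
           (auto simp: continuous_on_eq_continuous_within intro!: DERIV_continuous f')
    qed
    have "exp (2 * \<eta> * t) * (\<alpha> * (norm (y t))\<^sup>2) \<le> f t"
      using lower(2)[of "x t"] by (simp add: f_def y_def)
    also note \<open>f t \<le> f 0\<close>
    also have "f 0 \<le> norm (y 0) * norm (y 0) * K"
      using K(2)[of "y 0" "y 0"] by (simp add: f_def)
    finally have "exp (2 * \<eta> * t) * (\<alpha> * (norm (y t))\<^sup>2) \<le> norm (y 0) * norm (y 0) * K" .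
    then have "(norm (y t))\<^sup>2 \<le> K / \<alpha> * (exp (- \<eta> * t))\<^sup>2 * (norm (y 0))\<^sup>2"
      using lower(1) by (simp add: exp_double[symmetric] exp_minus field_simps power2_eq_square
        mult_exp_exp)
    also have "\<dots> = (sqrt (K / \<alpha>) * exp (- \<eta> * t) * norm (y 0))\<^sup>2"
      using K lower by (simp add: power_mult_distrib)
    finally show ?thesis
      using K(1) lower(1) unfolding y_def by (intro power2_le_imp_le[of "norm (P (x t))"]) auto
  qed
  then show ?thesis
    unfolding exp_estimate_def using K(1) lower(1)
    by (intro exI[of _ "sqrt (K / \<alpha>)"]) (auto simp: P(3))
qed

text \<open>The vector \<open>a + i b\<close> is a complex eigenvector for
  \<open>s + i \<tau>\<close>. The solutions it generates have size governed by
  \<open>exp (s * t)\<close>, and a nonzero projection makes this visible to the estimate.\<close>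

lemma exp_estimate_imp_le:
  fixes A :: "real^'k^'k"
  assumes est: "exp_estimate A V \<eta>"
    and P: "linear P" "\<And>x. orth_proj V x = P x"
    and a: "A *v a = s *\<^sub>R a - \<tau> *\<^sub>R b" and b: "A *v b = \<tau> *\<^sub>R a + s *\<^sub>R b"
    and nz: "P a \<noteq> 0 \<or> P b \<noteq> 0"
  shows "s \<le> - \<eta>"
proof (rule ccontr)
  assume "\<not> s \<le> - \<eta>"
  then have pos: "s + \<eta> > 0" by simp
  obtain \<kappa> where \<kappa>: "\<kappa> > 0" "\<And>x t. linear_ode_solution A x \<Longrightarrow> t \<ge> 0 \<Longrightarrow>
      norm (P (x t)) \<le> \<kappa> * exp (- \<eta> * t) * norm (P (x 0))"
    using est unfolding exp_estimate_def P by blast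
  \<comment> \<open>\<open>x1\<close> and \<open>x2\<close> are the real and imaginary parts of
    \<open>exp ((s + i \<tau>) t) (a + i b)\<close>.\<close>
  define x1 where "x1 t = (exp (s * t) * cos (\<tau> * t)) *\<^sub>R a - (exp (s * t) * sin (\<tau> * t)) *\<^sub>R b" for t
  define x2 where "x2 t = (exp (s * t) * sin (\<tau> * t)) *\<^sub>R a + (exp (s * t) * cos (\<tau> * t)) *\<^sub>R b" for t
  define R where "R = (norm (P a))\<^sup>2 + (norm (P b))\<^sup>2"
  have R: "R > 0"
    using nz unfolding R_def by (metis add_nonneg_pos add_pos_nonneg zero_le_power2
      zero_less_norm_iff zero_less_power)
  have sol1: "linear_ode_solution A x1"
    unfolding linear_ode_solution_def x1_def
    by (auto intro!: derivative_eq_intros simp: has_vector_derivative_def matrix_vector_mult_diff_distrib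
        matrix_vector_right_distrib
        matrix_vector_mult_scaleR a b algebra_simps)
  have sol2: "linear_ode_solution A x2"
    unfolding linear_ode_solution_def x2_def
    by (auto intro!: derivative_eq_intros simp: has_vector_derivative_def matrix_vector_mult_diff_distrib
        matrix_vector_right_distrib
        matrix_vector_mult_scaleR a b algebra_simps)
  \<comment> \<open>Adding the two squares cancels the oscillation, so the sum has an exact
    exponential law.\<close>
  have energy: "(norm (P (x1 t)))\<^sup>2 + (norm (P (x2 t)))\<^sup>2 = (exp (s * t))\<^sup>2 * R" for t
  proof -
    have expand: "(norm (P ((e * c) *\<^sub>R a - (e * r) *\<^sub>R b)))\<^sup>2 + (norm (P ((e * r) *\<^sub>R a + (e * c) *\<^sub>R b)))\<^sup>2
        = e\<^sup>2 * ((c\<^sup>2 + r\<^sup>2) * R)" for e c r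
      unfolding R_def using P(1)
      by (simp only: linear_add linear_diff linear_scale power2_norm_eq_inner inner_add_left inner_add_right
          inner_diff_left inner_diff_right inner_scaleR_left inner_scaleR_right inner_commute[of "P b" "P a"])
         (simp add: power2_eq_square algebra_simps)
    show ?thesis
      unfolding x1_def x2_def expand by simp
  qed
  have bound: "exp (2 * (s + \<eta>) * t) \<le> \<kappa>\<^sup>2" if "t \<ge> 0" for t
  proof -
    have "(norm (P (x1 t)))\<^sup>2 \<le> (\<kappa> * exp (- \<eta> * t) * norm (P (x1 0)))\<^sup>2"
         "(norm (P (x2 t)))\<^sup>2 \<le> (\<kappa> * exp (- \<eta> * t) * norm (P (x2 0)))\<^sup>2"
      using \<kappa>(2)[OF sol1 that] \<kappa>(2)[OF sol2 that] by (auto intro!: power_mono)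
    then have "(norm (P (x1 t)))\<^sup>2 + (norm (P (x2 t)))\<^sup>2 \<le> (\<kappa> * exp (- \<eta> * t))\<^sup>2 * 
        ((norm (P (x1 0)))\<^sup>2 + (norm (P (x2 0)))\<^sup>2)"
      by (simp add: power_mult_distrib distrib_left)
    then have "(exp (s * t))\<^sup>2 \<le> (\<kappa> * exp (- \<eta> * t))\<^sup>2"
      unfolding energy using R by simp
    then have "exp (2 * (s * t)) \<le> \<kappa>\<^sup>2 * exp (2 * (- \<eta> * t))"
      by (simp add: power_mult_distrib flip: exp_double)
    then have "exp (2 * (s * t)) * exp (2 * (\<eta> * t)) \<le> \<kappa>\<^sup>2 * exp (2 * (- \<eta> * t)) * exp (2 * (\<eta> * t))"
      by (intro mult_right_mono) auto
    then show ?thesis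
      by (simp add: mult_exp_exp algebra_simps)
  qed
  \<comment> \<open>At this time \<open>1 + 2 * (s + \<eta>) * t\<close> equals
    \<open>1 + 2 * \<kappa>\<^sup>2\<close>, which exceeds the bound
    \<open>\<kappa>\<^sup>2\<close>.\<close>
  define t where "t = \<kappa>\<^sup>2 / (s + \<eta>)"
  have "1 + 2 * (s + \<eta>) * t \<le> \<kappa>\<^sup>2"
  proof (rule order_trans[OF exp_ge_add_one_self bound])
    show "t \<ge> 0"
      using pos by (simp add: t_def)
  qed
  moreover have "2 * (s + \<eta>) * t = 2 * \<kappa>\<^sup>2"
    using pos by (simp add: t_def del: distrib_left_numeral distrib_left)
  ultimately show False
    using zero_le_power2[of \<kappa>] by linarith
qed

section \<open>Eigenvalues\<close>

lemma poly_charpoly: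
  fixes A :: "'a::comm_ring_1^'k^'k"
  shows "poly (charpoly A) z = det (mat z - A)"
  by (simp add: charpoly_def det_def poly_sum poly_prod poly_mult mat_def)
     (intro sum.cong refl arg_cong2[where f="(*)"] prod.cong, auto)

lemma det_complex_matrix: "det (complex_matrix A) = complex_of_real (det A)"
  by (simp add: det_def map_matrix_def)

lemma eigenvalues_subset_roots:
  "eigenvalues A \<subseteq> {z. poly (charpoly (complex_matrix A)) z = 0}"
proof
  fix z assume "z \<in> eigenvalues A"
  then obtain v where v: "v \<noteq> 0" "complex_matrix A *v v = z *s v"
    by (auto simp: eigenvalues_def)
  have "mat z *v v = z *s v"
    by (simp add: mat_def matrix_vector_mult_def vec_eq_iff if_distrib if_distribR cong: if_cong)
  then have "(mat z - complex_matrix A) *v v = 0"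
    using v(2) by (simp add: matrix_vector_mult_diff_rdistrib)
  then have "\<not> invertible (mat z - complex_matrix A)"
    using v(1) by (auto simp: invertible_left_inverse matrix_left_invertible_ker)
  then show "z \<in> {z. poly (charpoly (complex_matrix A)) z = 0}"
    by (simp add: poly_charpoly invertible_det_nz)
qed

text \<open>Replacing a column of \<open>z - A\<close> by the sum of all columns, which is \<open>z\<close> times the all-ones
  vector, splits off one factor \<open>z\<close> of the characteristic polynomial.\<close>

lemma simple_zero_eigenvalue:
  fixes A :: "real^'k^'k"
  assumes one: "A *v 1 = 0" and ker: "\<And>x. A *v x = 0 \<Longrightarrow> \<exists>c. x = vec c"
    and range: "\<And>x. A *v x \<noteq> 1"
  shows "simple_eigenvalue A 0" and "finite (eigenvalues A)"
proof -
  fix k :: 'k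
  let ?C = "complex_matrix A"
  define r where "r = det (\<chi> i j. if j = k then 1 else (if i = j then [:0, 1:] else 0) - [:?C $ i $ j:])"
  have C1: "?C *v 1 = 0"
    using one by (simp add: vec_eq_iff matrix_vector_mult_def map_matrix_def flip: of_real_sum)
  have "poly (charpoly ?C) z = poly ([:0, 1:] * r) z" for z
  proof -
    let ?B = "mat z - ?C"
    have "mat z *v (1::complex^'k) = vec z"
      by (simp add: mat_def matrix_vector_mult_def vec_eq_iff if_distrib if_distribR cong: if_cong)
    then have B1: "?B *v 1 = vec z"
      by (simp add: matrix_vector_mult_diff_rdistrib C1)
    have "poly (charpoly ?C) z = 1 $ k * det ?B"
      by (simp add: poly_charpoly)
    \<comment> \<open>Cramer's rule for \<open>?B *v 1 = vec z\<close>.\<close>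
    also have "\<dots> = det (\<chi> i j. if j = k then vec z $ i else ?B $ i $ j)"
      using cramer_lemma[of k ?B 1] by (simp only: B1)
    also have "\<dots> = det (transpose (\<chi> i j. if j = k then vec z $ i else ?B $ i $ j))"
      by (simp add: det_transpose)
    also have "transpose (\<chi> i j. if j = k then vec z $ i else ?B $ i $ j)
        = (\<chi> i. if i = k then z *s 1 else column i ?B)"
      by (auto simp: transpose_def column_def vec_eq_iff)
    also have "det \<dots> = z * det (\<chi> i. if i = k then 1 else column i ?B)"
      by (rule det_row_mul)
    also have "(\<chi> i. if i = k then 1 else column i ?B)
        = transpose (\<chi> i j. if j = k then 1 else ?B $ i $ j)"
      by (auto simp: transpose_def column_def vec_eq_iff)
    also have "det \<dots> = poly r z"
      unfolding det_transpose r_def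
      by (simp add: det_def poly_sum poly_prod poly_mult mat_def)
         (intro sum.cong refl arg_cong2[where f="(*)"] prod.cong, auto simp: mat_def)
    finally show ?thesis by simp
  qed
  then have char: "charpoly ?C = [:0, 1:] * r"
    by (simp add: poly_eq_poly_eq_iff[symmetric] fun_eq_iff)
  \<comment> \<open>The matrix behind \<open>r\<close> at \<open>0\<close>, over the reals; its
    invertibility makes the order of the root exactly one. A kernel vector \<open>x\<close> gives
    \<open>A *v y = x $ k *s 1\<close>, so \<open>range\<close> forces \<open>x $ k = 0\<close>, and
    then \<open>y\<close> is constant with a zero entry.\<close>
  define A' where "A' = (\<chi> i j. if j = k then 1 else - A $ i $ j)"
  have "x = 0" if x: "A' *v x = 0" for x
  proof -
    define y where "y = (\<chi> j. if j = k then 0 else x $ j)"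
    have "(A' *v x) $ i = x $ k - (A *v y) $ i" for i
      by (simp add: A'_def y_def matrix_vector_mult_def sum.remove[of UNIV k] sum_negf)
    then have Ay: "A *v y = x $ k *s 1"
      using x by (simp add: vec_eq_iff)
    have xk: "x $ k = 0"
    proof (rule ccontr)
      assume "x $ k \<noteq> 0"
      then have "A *v (inverse (x $ k) *s y) = 1"
        using Ay by (simp add: vec_eq_iff matrix_vector_mult_def sum_distrib_left[symmetric] mult.left_commute)
      with range show False by blast
    qed
    then obtain c where "y = vec c"
      using ker[of y] Ay by auto
    moreover have "y $ k = 0"
      by (simp add: y_def)
    ultimately have "y $ j = 0" for j
      by simp
    then have "x $ j = 0" for j
      using xk by (cases "j = k") (auto simp: y_def split: if_splits dest: meta_spec[of _ j])
    then show ?thesis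
      by (simp add: vec_eq_iff)
  qed
  then have "det A' \<noteq> 0"
    by (metis invertible_det_nz invertible_left_inverse matrix_left_invertible_ker)
  moreover have "poly r 0 = det (complex_matrix A')"
    unfolding r_def A'_def
    by (simp add: det_def poly_sum poly_prod poly_mult)
       (intro sum.cong refl arg_cong2[where f="(*)"] prod.cong, auto simp: map_matrix_def)
  ultimately have r0: "poly r 0 \<noteq> 0"
    by (simp add: det_complex_matrix)
  then have "order 0 (charpoly ?C) = 1"
    unfolding char using order_power_n_n[of "0::complex" 1]
    by (subst order_mult) (auto simp: order_0I)
  moreover have "0 \<in> eigenvalues A"
    unfolding eigenvalues_def using C1 by (auto intro!: exI[of _ 1])
  ultimately show "simple_eigenvalue A 0"
    by (simp add: simple_eigenvalue_def)
  have "charpoly ?C \<noteq> 0"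
    using r0 by (auto simp: char)
  then show "finite (eigenvalues A)"
    using eigenvalues_subset_roots poly_roots_finite finite_subset by blast
qed

lemma complex_matrix_mult_Re_Im:
  fixes A :: "real^'k^'k" and v :: "complex^'k"
  shows "Re ((complex_matrix A *v v) $ i) = (A *v (\<chi> i. Re (v $ i))) $ i"
    and "Im ((complex_matrix A *v v) $ i) = (A *v (\<chi> i. Im (v $ i))) $ i"
  by (simp_all add: matrix_vector_mult_def map_matrix_def)

text \<open>Real and imaginary parts of an eigenvector let complex eigenvalues be handled with real
  solutions and real block vectors.\<close>

lemma eigenvalues_iff_real_pair:
  fixes A :: "real^'k^'k"
  shows "z \<in> eigenvalues A \<longleftrightarrow> (\<exists>a b. (a \<noteq> 0 \<or> b \<noteq> 0)
    \<and> A *v a = Re z *\<^sub>R a - Im z *\<^sub>R b \<and> A *v b = Im z *\<^sub>R a + Re z *\<^sub>R b)"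
    (is "_ \<longleftrightarrow> ?R")
proof
  assume "z \<in> eigenvalues A"
  then obtain v where v: "v \<noteq> 0" "complex_matrix A *v v = z *s v"
    by (auto simp: eigenvalues_def)
  define a b where "a = (\<chi> i. Re (v $ i))" and "b = (\<chi> i. Im (v $ i))"
  have "a \<noteq> 0 \<or> b \<noteq> 0"
    using v(1) by (auto simp: a_def b_def vec_eq_iff complex_eq_iff)
  moreover have "A *v a = Re z *\<^sub>R a - Im z *\<^sub>R b" "A *v b = Im z *\<^sub>R a + Re z *\<^sub>R b"
    using complex_matrix_mult_Re_Im[of A v] v(2)
    by (simp_all add: vec_eq_iff a_def b_def algebra_simps)
  ultimately show ?R by blast
next
  assume ?R
  then obtain a b where ab: "a \<noteq> 0 \<or> b \<noteq> 0" "A *v a = Re z *\<^sub>R a - Im z *\<^sub>R b"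
      "A *v b = Im z *\<^sub>R a + Re z *\<^sub>R b"
    by blast
  define v where "v = (\<chi> i. Complex (a $ i) (b $ i))"
  have v: "(\<chi> i. Re (v $ i)) = a" "(\<chi> i. Im (v $ i)) = b"
    by (simp_all add: v_def vec_eq_iff)
  have "complex_matrix A *v v = z *s v"
    using complex_matrix_mult_Re_Im[of A v] unfolding v
    by (simp add: vec_eq_iff complex_eq_iff ab) (simp add: v_def algebra_simps)
  moreover have "v \<noteq> 0"
  proof
    assume "v = 0"
    with v have "a = 0" "b = 0"
      by (simp_all add: vec_eq_iff)
    with ab(1) show False by simp
  qed
  ultimately show "z \<in> eigenvalues A"
    by (auto simp: eigenvalues_def)
qed

text \<open>The vectors \<open>x\<close>, \<open>y\<close> form a Jordan chain: \<open>A - s\<close>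
  sends \<open>x\<close> to \<open>y\<close> and \<open>y\<close> to zero.\<close>

lemma not_semisimple_eigenvalueI:
  fixes A :: "real^'k^'k"
  assumes "A *v x = s *\<^sub>R x + y" "A *v y = s *\<^sub>R y" "y \<noteq> 0"
  shows "\<not> semisimple_eigenvalue A (of_real s)"
proof -
  define cv where "cv x = (\<chi> i. complex_of_real (x $ i))" for x :: "real^'k"
  define B where "B = complex_matrix A - mat (of_real s)"
  have mat: "mat (of_real s) *v cv u = cv (s *\<^sub>R u)" for u
    by (simp add: cv_def mat_def matrix_vector_mult_def vec_eq_iff
        if_distrib[of "\<lambda>a. a * _"] cong: if_cong)
  have "B *v cv u = cv (A *v u - s *\<^sub>R u)" for u
    unfolding B_def matrix_vector_mult_diff_rdistrib mat
    by (simp add: cv_def matrix_vector_mult_def map_matrix_def vec_eq_iff)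
  then have "B *v cv x = cv y" "B *v cv y = 0"
    using assms by (simp_all add: cv_def vec_eq_iff)
  moreover have "cv y \<noteq> 0"
    using assms(3) by (auto simp: cv_def vec_eq_iff)
  ultimately show ?thesis
    unfolding semisimple_eigenvalue_def B_def[symmetric] Let_def by metis
qed

section \<open>Laplacians and zero-average vectors\<close>

lemma mem_H1_iff: "v \<in> H1 \<longleftrightarrow> 1 \<bullet> v = 0"
  by (simp add: H1_def inner_vec_def)

lemma subspace_H1: "subspace (H1 :: (real^'n) set)"
  by (simp add: subspace_def mem_H1_iff inner_add_right)

lemma vec_in_H1_iff: "(vec c :: real^'n) \<in> H1 \<longleftrightarrow> c = 0"
  by (simp add: mem_H1_iff inner_vec_def)

lemma H1_nontrivial:
  assumes "CARD('n::finite) \<ge> 2"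
  shows "(H1 :: (real^'n) set) \<noteq> {0}"
proof -
  have "\<not> (UNIV :: 'n set) \<subseteq> {undefined}"
    using assms card_mono[of "{undefined}" "UNIV :: 'n set"] by auto
  then obtain i j :: 'n where "i \<noteq> j" by blast
  then have "axis i 1 - axis j 1 \<noteq> (0 :: real^'n)"
    by (simp add: axis_eq_axis)
  moreover have "axis i 1 - axis j 1 \<in> (H1 :: (real^'n) set)"
    by (simp add: mem_H1_iff inner_diff_right inner_axis)
  ultimately show ?thesis by blast
qed

lemma diag_matrix_mult_vector: "(diag_matrix f *v x) $ i = f i * x $ i"
  by (simp add: diag_matrix_def matrix_vector_mult_def if_distrib[of "\<lambda>a. a * _"] cong: if_cong)

text \<open>The transposed incidence matrix takes differences along edges. Symmetry,
  semidefiniteness and the kernel are later read off this sum.\<close>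

lemma laplacian_form:
  fixes E :: "('n::finite \<times> 'n) set"
  shows "x \<bullet> (laplacian E w *v y)
    = (\<Sum>(i, j)\<in>E. w i j * (x $ i - x $ j) * (y $ i - y $ j))"
proof -
  let ?B = "incidence_matrix E"
  have B: "(u v* ?B) $ e = (if e \<in> E then u $ fst e - u $ snd e else 0)" for u e
  proof (cases "e \<in> E")
    case True
    then have "(u v* ?B) $ e = (\<Sum>k\<in>UNIV. (if k = fst e then u $ k else 0) - (if k = snd e then u $ k else 0))"
      unfolding incidence_matrix_def vector_matrix_mult_def
      by (auto intro!: sum.cong)
    with True show ?thesis
      by (simp add: sum_subtractf)
  next
    case False
    then show ?thesis
      by (simp add: incidence_matrix_def vector_matrix_mult_def)
  qed
  have "x \<bullet> (laplacian E w *v y) = (x v* ?B) \<bullet> (diag_matrix (\<lambda>(i, j). w i j) *v (y v* ?B))"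
    by (simp add: laplacian_def dot_lmul_matrix flip: matrix_vector_mul_assoc)
  also have "\<dots> = (\<Sum>e\<in>UNIV. if e \<in> E then
      (case e of (i, j) \<Rightarrow> w i j * (x $ i - x $ j) * (y $ i - y $ j)) else 0)"
    unfolding inner_vec_def
    by (intro sum.cong) (auto simp: B diag_matrix_mult_vector)
  also have "\<dots> = (\<Sum>(i, j)\<in>E. w i j * (x $ i - x $ j) * (y $ i - y $ j))"
    by (simp add: sum.If_cases)
  finally show ?thesis .
qed

text \<open>Abstracts the Laplacian of a weakly connected graph, so that \<open>L\<close> and
  \<open>M\<close> share their lemmas. The kernel is described through the quadratic form because
  vanishing energy is what arguments by semidefiniteness produce.\<close>

definition consensus_matrix :: "real^'n^'n \<Rightarrow> bool" where
  "consensus_matrix A \<longleftrightarrow> (\<forall>x y. x \<bullet> (A *v y) = y \<bullet> (A *v x)) \<and> (\<forall>x. 0 \<le> x \<bullet> (A *v x))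
     \<and> A *v 1 = 0 \<and> (\<forall>x. x \<bullet> (A *v x) = 0 \<longrightarrow> (\<exists>c. x = vec c))"

text \<open>A vanishing sum of positively weighted squares makes \<open>x\<close> agree across each
  edge, hence along every undirected path.\<close>

lemma consensus_matrix_laplacian:
  fixes E :: "('n::finite \<times> 'n) set"
  assumes "weakly_connected_weighted_digraph E w"
  shows "consensus_matrix (laplacian E w)"
proof -
  have w: "w i j > 0" if "(i, j) \<in> E" for i j
    using assms that by (auto simp: weakly_connected_weighted_digraph_def)
  have nonneg: "0 \<le> (case e of (i, j) \<Rightarrow> w i j * (x $ i - x $ j) * (x $ i - x $ j))" if "e \<in> E" for e x
    using w that by (auto simp: mult.assoc less_imp_le split: prod.split)
  have "\<exists>c. x = vec c" if "x \<bullet> (laplacian E w *v x) = 0" for x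
  proof -
    have "\<forall>e\<in>E. (case e of (i, j) \<Rightarrow> w i j * (x $ i - x $ j) * (x $ i - x $ j)) = 0"
      using that nonneg by (subst (asm) laplacian_form, subst (asm) sum_nonneg_eq_0_iff) auto
    then have edge: "x $ i = x $ j" if "(i, j) \<in> E" for i j
      using w[OF that] that by fastforce
    have path: "x $ i = x $ j" if "(i, j) \<in> (E \<union> E\<inverse>)\<^sup>*" for i j
      using that by (induction rule: rtrancl_induct) (auto simp: edge)
    have "x $ i = x $ j" for i j
      using assms path by (simp add: weakly_connected_weighted_digraph_def)
    then have "x = vec (x $ undefined)"
      by (simp add: vec_eq_iff)
    then show ?thesis by blast
  qed
  \<comment> \<open>The form with second argument \<open>1\<close> vanishes, in particular against
    \<open>laplacian E w *v 1\<close> itself.\<close>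
  moreover have "laplacian E w *v 1 = 0"
    by (rule inner_eq_zero_iff[THEN iffD1]) (simp add: laplacian_form)
  moreover have "0 \<le> x \<bullet> (laplacian E w *v x)" for x
    unfolding laplacian_form by (intro sum_nonneg nonneg)
  moreover have "x \<bullet> (laplacian E w *v y) = y \<bullet> (laplacian E w *v x)" for x y
    unfolding laplacian_form by (intro sum.cong) auto
  ultimately show ?thesis
    by (simp add: consensus_matrix_def)
qed

lemma consensus_matrix_scaleR:
  assumes "consensus_matrix A" "k > 0"
  shows "consensus_matrix (k *\<^sub>R A)"
  using assms by (auto simp: consensus_matrix_def matrix_vector_mult_scaleR scaleR_matrix_vector_assoc[symmetric])

lemma weakly_connected_orientation:
  assumes "connected_weighted_graph E a" "orientation_of F E"
  shows "weakly_connected_weighted_digraph F a"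
  using assms
  by (auto simp: connected_weighted_graph_def orientation_of_def weakly_connected_weighted_digraph_def)

text \<open>By symmetry, \<open>1 \<bullet> (A *v x) = x \<bullet> (A *v 1) = 0\<close>.\<close>

lemma consensus_matrix_H1:
  assumes "consensus_matrix A"
  shows "A *v x \<in> H1"
  using assms unfolding consensus_matrix_def mem_H1_iff by (metis inner_zero_right)

lemma consensus_matrix_pos:
  assumes "consensus_matrix A" "x \<in> H1" "x \<noteq> 0"
  shows "0 < x \<bullet> (A *v x)"
proof -
  have "x \<bullet> (A *v x) \<noteq> 0"
  proof
    assume "x \<bullet> (A *v x) = 0"
    then obtain c where "x = vec c"
      using assms(1) by (auto simp: consensus_matrix_def)
    with assms(2,3) show False
      by (auto simp: vec_in_H1_iff vec_eq_iff)
  qed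
  moreover have "0 \<le> x \<bullet> (A *v x)"
    using assms(1) by (auto simp: consensus_matrix_def)
  ultimately show ?thesis by simp
qed

section \<open>Consensus with a first-order filter\<close>

text \<open>Common interface of the two cases: on \<open>H1\<close> the form
  \<open>x \<bullet> (G *v y)\<close> is an inner product for which \<open>Q\<close> is selfadjoint
  and positive definite.\<close>

locale filtered_consensus =
  fixes Q G :: "real^'n::finite^'n" and \<omega> :: real
  assumes card: "CARD('n) \<ge> 2" and \<omega>_pos: "\<omega> > 0"
    and Q_one: "Q *v 1 = 0"
    and Q_H1: "\<And>x. Q *v x \<in> H1"
    and G_sym: "\<And>x y. x \<bullet> (G *v y) = y \<bullet> (G *v x)"
    and G_pos: "\<And>x. x \<in> H1 \<Longrightarrow> x \<noteq> 0 \<Longrightarrow> 0 < x \<bullet> (G *v x)"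
    and GQ_sym: "\<And>x y. x \<bullet> (G *v (Q *v y)) = y \<bullet> (G *v (Q *v x))"
    and GQ_pos: "\<And>x. x \<in> H1 \<Longrightarrow> x \<noteq> 0 \<Longrightarrow> 0 < x \<bullet> (G *v (Q *v x))"

text \<open>With \<open>G = M\<close> the product \<open>M L M\<close> is symmetric, and its form at
  \<open>x\<close> is that of \<open>L\<close> at \<open>M *v x\<close>, a nonzero element of
  \<open>H1\<close>.\<close>

lemma filtered_consensus_unscaled:
  fixes L M :: "real^'n::finite^'n"
  assumes "CARD('n) \<ge> 2" "\<omega> > 0" and L: "consensus_matrix L" and M: "consensus_matrix M"
  shows "filtered_consensus (L ** M) M \<omega>"
proof
  have LM: "(L ** M) *v x = L *v (M *v x)" for x
    by (simp flip: matrix_vector_mul_assoc)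
  have L_sym: "x \<bullet> (L *v y) = y \<bullet> (L *v x)" and M_sym: "x \<bullet> (M *v y) = y \<bullet> (M *v x)" for x y
    using L M by (auto simp: consensus_matrix_def)
  show "(L ** M) *v 1 = 0"
    using M by (simp add: LM consensus_matrix_def)
  show "(L ** M) *v x \<in> H1" for x
    unfolding LM by (rule consensus_matrix_H1[OF L])
  show "x \<bullet> (M *v ((L ** M) *v y)) = y \<bullet> (M *v ((L ** M) *v x))" for x y
    unfolding LM by (metis L_sym M_sym inner_commute)
  show "0 < x \<bullet> (M *v ((L ** M) *v x))" if "x \<in> H1" "x \<noteq> 0" for x
  proof -
    have "M *v x \<noteq> 0"
      using consensus_matrix_pos[OF M that] by auto
    then have "0 < (M *v x) \<bullet> (L *v (M *v x))"
      using consensus_matrix_H1[OF M] by (intro consensus_matrix_pos[OF L])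
    then show ?thesis
      unfolding LM by (metis M_sym inner_commute)
  qed
  show "x \<bullet> (M *v y) = y \<bullet> (M *v x)" for x y
    by (rule M_sym)
qed (use assms consensus_matrix_pos[OF M] in auto)

text \<open>Positivity of \<open>Q = L D M\<close>: the minimum \<open>m\<close> of the Rayleigh quotient of \<open>Q\<close> against \<open>D\<inverse>\<close> is
  attained at some \<open>y\<close> with \<open>Q y = m D\<inverse> y\<close>.  Testing this against \<open>z = D M y\<close> gives
  \<open>z \<bullet> L z = m (y \<bullet> M y)\<close>, which rules out \<open>m < 0\<close>.\<close>

lemma filtered_consensus_commuting:
  fixes L M :: "real^'n::finite^'n"
  assumes "CARD('n) \<ge> 2" "\<omega> > 0" and L: "consensus_matrix L" and M: "consensus_matrix M"
    and d: "\<And>i. d i > 0" and comm: "L ** diag_matrix d ** M = M ** diag_matrix d ** L"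
  shows "filtered_consensus (L ** diag_matrix d ** M) (mat 1) \<omega>"
proof -
  define D where "D = diag_matrix d"
  define D' where "D' = diag_matrix (\<lambda>i. 1 / d i)"
  define Q where "Q = L ** D ** M"
  have Qx: "Q *v x = L *v (D *v (M *v x))" and Qx': "Q *v x = M *v (D *v (L *v x))" for x
    unfolding Q_def D_def by (simp add: matrix_vector_mul_assoc matrix_mul_assoc)
      (simp add: comm matrix_vector_mul_assoc matrix_mul_assoc)
  have L_sym: "x \<bullet> (L *v y) = y \<bullet> (L *v x)" and M_sym: "x \<bullet> (M *v y) = y \<bullet> (M *v x)" for x y
    using L M by (auto simp: consensus_matrix_def)
  have D_inner: "x \<bullet> (D *v y) = (\<Sum>i\<in>UNIV. d i * x $ i * y $ i)" for x y
    by (simp add: D_def inner_vec_def diag_matrix_mult_vector algebra_simps)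
  have D_sym: "x \<bullet> (D *v y) = y \<bullet> (D *v x)" for x y
    unfolding D_inner by (intro sum.cong) auto
  have D'_inner: "x \<bullet> (D' *v y) = (\<Sum>i\<in>UNIV. x $ i * y $ i / d i)" for x y
    by (simp add: D'_def inner_vec_def diag_matrix_mult_vector)
  have D'_sym: "x \<bullet> (D' *v y) = y \<bullet> (D' *v x)" for x y
    unfolding D'_inner by (intro sum.cong) auto
  have D'_pos: "0 < x \<bullet> (D' *v x)" if nz: "x \<noteq> 0" for x
  proof -
    obtain i where "x $ i \<noteq> 0"
      using nz by (metis vec_eq_iff zero_index)
    then have "0 < x $ i * x $ i / d i"
      using d[of i] by (metis divide_pos_pos not_real_square_gt_zero)
    then show ?thesis
      unfolding D'_inner using d by (intro sum_pos2[of _ i]) (auto simp: less_imp_le)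
  qed
  have D'D: "D' *v (D *v x) = x" for x
    using d by (simp add: vec_eq_iff D_def D'_def diag_matrix_mult_vector less_imp_neq[symmetric])
  \<comment> \<open>The transpose of \<open>L D M\<close> is \<open>M D L\<close>, so the
    commutation hypothesis is exactly symmetry of \<open>Q\<close>.\<close>
  have Q_sym: "x \<bullet> (Q *v y) = y \<bullet> (Q *v x)" for x y
    by (metis Qx Qx' L_sym M_sym D_sym inner_commute)
  \<comment> \<open>From \<open>L *v (D *v (M *v x)) = 0\<close> follows
    \<open>M *v x = D' *v vec c\<close>. The left side has zero sum while \<open>D'\<close> has
    positive diagonal, so \<open>c = 0\<close>.\<close>
  have const: "\<exists>c. x = vec c" if "Q *v x = 0" for x
  proof -
    have "L *v (D *v (M *v x)) = 0"
      using that by (simp add: Qx)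
    then obtain c where "D *v (M *v x) = vec c"
      using L by (metis consensus_matrix_def inner_zero_right)
    then have Mx: "M *v x = D' *v vec c"
      by (metis D'D)
    have "1 \<bullet> (D' *v vec c) = 0"
      using consensus_matrix_H1[OF M, of x] by (simp add: Mx mem_H1_iff)
    then have "c * (1 \<bullet> (D' *v 1)) = 0"
      by (simp add: D'_inner sum_distrib_left)
    then have "c = 0"
      using D'_pos[of 1] by simp
    then have "M *v x = 0"
      unfolding Mx by (simp add: vec_eq_iff D'_def diag_matrix_mult_vector)
    then show ?thesis
      using M by (metis consensus_matrix_def inner_zero_right)
  qed
  \<comment> \<open>Minimising over the whole space makes stationarity hold against every vector,
    which is a genuine equation for \<open>Q *v y\<close>.\<close>
  obtain m y where y: "y \<noteq> 0" "\<And>x. m * (x \<bullet> (D' *v x)) \<le> x \<bullet> (Q *v x)"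
      "\<And>x. x \<bullet> (Q *v y - m *\<^sub>R (D' *v y)) = 0"
  proof (rule rayleigh_minimum[of "(*v) Q" "(*v) D'" UNIV])
    show "(UNIV :: (real^'n) set) \<noteq> {0}"
      using H1_nontrivial[OF assms(1)] subspace_0[OF subspace_H1] by blast
  qed (auto simp: Q_sym D'_sym D'_pos)
  have Qy: "Q *v y = m *\<^sub>R (D' *v y)"
    using y(3)[of "Q *v y - m *\<^sub>R (D' *v y)"] by simp
  have "m \<ge> 0"
  proof (rule ccontr)
    assume m: "\<not> m \<ge> 0"
    define z where "z = D *v (M *v y)"
    have "z \<bullet> (L *v z) = z \<bullet> (m *\<^sub>R (D' *v y))"
      by (simp add: z_def flip: Qx Qy)
    also have "\<dots> = m * (y \<bullet> (M *v y))"
      unfolding z_def by (metis D'_sym D'D inner_scaleR_right)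
    finally have "m * (y \<bullet> (M *v y)) \<ge> 0"
      using L by (metis consensus_matrix_def)
    moreover have "y \<bullet> (M *v y) \<ge> 0"
      using M by (auto simp: consensus_matrix_def)
    ultimately have "y \<bullet> (M *v y) = 0"
      using m by (auto simp: zero_le_mult_iff)
    then obtain c where "y = vec c"
      using M by (auto simp: consensus_matrix_def)
    then have "y = c *\<^sub>R 1"
      by (simp add: vec_eq_iff)
    then have "M *v y = 0"
      using M by (simp add: consensus_matrix_def matrix_vector_mult_scaleR)
    then have "m *\<^sub>R (D' *v y) = 0"
      by (simp flip: Qy add: Qx)
    then have "y \<bullet> (D' *v y) = 0"
      using m by simp
    with D'_pos[OF y(1)] show False by simp
  qed
  then have nonneg: "0 \<le> x \<bullet> (Q *v x)" for x
  proof (cases "x = 0")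
    case False
    then have "0 \<le> m * (x \<bullet> (D' *v x))"
      using D'_pos \<open>m \<ge> 0\<close> by (simp add: less_imp_le)
    then show ?thesis
      using y(2)[of x] by simp
  qed simp
  have pos: "0 < x \<bullet> (Q *v x)" if "x \<in> H1" "x \<noteq> 0" for x
  proof -
    have "x \<bullet> (Q *v x) \<noteq> 0"
    proof
      assume "x \<bullet> (Q *v x) = 0"
      \<comment> \<open>Testing the null vector \<open>x\<close> of the semidefinite form against
        \<open>Q *v x\<close> puts \<open>x\<close> in the kernel of \<open>Q\<close>.\<close>
      then have "(Q *v x) \<bullet> (Q *v x) = 0"
        by (rule psd_form_null[OF matrix_vector_mul_linear subspace_UNIV Q_sym nonneg UNIV_I _ UNIV_I])
      then obtain c where "x = vec c"
        using const by auto
      with that show False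
        by (auto simp: vec_in_H1_iff vec_eq_iff)
    qed
    with nonneg[of x] show ?thesis by simp
  qed
  show ?thesis
    unfolding D_def[symmetric] Q_def[symmetric]
  proof
    show "Q *v 1 = 0"
      using M by (simp add: Qx consensus_matrix_def)
    show "Q *v x \<in> H1" for x
      unfolding Qx by (rule consensus_matrix_H1[OF L])
    show "x \<bullet> (mat 1 *v (Q *v y)) = y \<bullet> (mat 1 *v (Q *v x))" for x y
      using Q_sym by simp
    show "x \<bullet> (mat 1 *v y) = y \<bullet> (mat 1 *v x)" for x y :: "real^'n"
      by (simp add: inner_commute)
  qed (use assms pos in auto)
qed

section \<open>Block vectors and the projection onto zero-average blocks\<close>

definition upper_block :: "'a^('m::finite + 'n::finite) \<Rightarrow> 'a^'m" where
  "upper_block z = (\<chi> k. z $ Inl k)"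

definition lower_block :: "'a^('m::finite + 'n::finite) \<Rightarrow> 'a^'n" where
  "lower_block z = (\<chi> k. z $ Inr k)"

lemma block_stack [simp]: "upper_block (stack u v) = u" "lower_block (stack u v) = v"
  by (simp_all add: upper_block_def lower_block_def stack_def)

lemma stack_blocks: "stack (upper_block z) (lower_block z) = z"
  by (simp add: upper_block_def lower_block_def stack_def vec_eq_iff split: sum.split)

lemma stack_eq_iff: "stack u v = stack u' v' \<longleftrightarrow> u = u' \<and> v = v'"
  by (metis block_stack)

lemma blocks_linear:
  "upper_block (x + y) = upper_block x + upper_block y"
  "lower_block (x + y) = lower_block x + lower_block y"
  "upper_block (r *\<^sub>R x) = r *\<^sub>R upper_block x"
  "lower_block (r *\<^sub>R x) = r *\<^sub>R lower_block x"
  for x y :: "real^('m::finite + 'n::finite)"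
  by (simp_all add: upper_block_def lower_block_def vec_eq_iff)

lemma stack_linear:
  "stack (u + u') (v + v') = stack u v + stack u' v'"
  "stack (u - u') (v - v') = stack u v - stack u' v'"
  "stack (r *\<^sub>R u) (r *\<^sub>R v) = r *\<^sub>R stack u v"
  "stack 0 0 = 0"
  for u u' :: "real^'m" and v v' :: "real^'n"
  by (simp_all add: vec_eq_iff stack_def split: sum.split)

lemma inner_stack: "stack u v \<bullet> stack u' v' = u \<bullet> u' + v \<bullet> v'"
  for u u' :: "real^'m" and v v' :: "real^'n"
  by (simp add: inner_vec_def stack_def UNIV_Plus_UNIV [symmetric] sum.Plus del: UNIV_Plus_UNIV)

lemma stack_vec: "stack (vec c) (vec c) = vec c"
  by (simp add: vec_eq_iff stack_def split: sum.split)

text \<open>Orthogonal projection onto \<open>H1\<close>: the subtracted constant is the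
  mean.\<close>

definition centre :: "real^'n::finite \<Rightarrow> real^'n" where
  "centre u = u - vec ((1 \<bullet> u) / CARD('n))"

lemma one_inner_vec: "(1 :: real^'n) \<bullet> vec c = real CARD('n) * c"
  by (simp add: inner_vec_def)

lemma linear_centre: "linear centre"
  by (rule linearI) (auto simp: centre_def vec_eq_iff inner_add_right algebra_simps add_divide_distrib)

lemma centre_H1: "centre u \<in> H1" for u :: "real^'n::finite"
  using one_inner_vec[of "(1 \<bullet> u) / real CARD('n)", where 'n='n] by (simp add: centre_def mem_H1_iff inner_diff_right)

lemma centre_id: "u \<in> H1 \<Longrightarrow> centre u = u"
  by (simp add: centre_def mem_H1_iff vec_eq_iff)

lemma centre_eq_0D: "centre u = 0 \<Longrightarrow> \<exists>c. u = vec c"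
  by (auto simp: centre_def)

lemma inner_centre: "h \<in> H1 \<Longrightarrow> (u - centre u) \<bullet> h = 0"
  by (simp add: centre_def mem_H1_iff inner_vec_def flip: sum_distrib_left sum_divide_distrib)

definition block_centre :: "real^('n::finite + 'n) \<Rightarrow> real^('n + 'n)" where
  "block_centre z = stack (centre (upper_block z)) (centre (lower_block z))"

lemma block_centre_stack [simp]: "block_centre (stack u v) = stack (centre u) (centre v)"
  by (simp add: block_centre_def)

lemma linear_block_centre: "linear block_centre"
  by (rule linearI) (simp_all add: block_centre_def blocks_linear linear_add[OF linear_centre]
      linear_scale[OF linear_centre] stack_linear)

lemma subspace_H1_times_H1: "subspace (H1_times_H1 :: (real^('n::finite + 'n)) set)"
proof -
  have "z \<in> H1_times_H1 \<longleftrightarrow> upper_block z \<in> H1 \<and> lower_block z \<in> H1" for z :: "real^('n + 'n)"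
    unfolding H1_times_H1_def by (auto intro: stack_blocks[symmetric])
  moreover have "upper_block (0 :: real^('n + 'n)) = 0" "lower_block (0 :: real^('n + 'n)) = 0"
    by (simp_all add: upper_block_def lower_block_def vec_eq_iff)
  ultimately show ?thesis
    using subspace_H1[where 'n = 'n] by (auto simp: subspace_def blocks_linear)
qed

lemma orth_proj_H1_times_H1: "orth_proj H1_times_H1 z = block_centre z"
  for z :: "real^('n::finite + 'n)"
proof (rule orth_proj_eqI[OF subspace_H1_times_H1])
  show "block_centre z \<in> H1_times_H1"
    unfolding block_centre_def H1_times_H1_def using centre_H1 by blast
next
  fix h assume "h \<in> (H1_times_H1 :: (real^('n + 'n)) set)"
  then obtain u v where h: "h = stack u v" "u \<in> H1" "v \<in> H1"
    by (auto simp: H1_times_H1_def)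
  have "z - block_centre z = stack (upper_block z - centre (upper_block z)) (lower_block z - centre (lower_block z))"
    by (simp add: stack_linear stack_blocks block_centre_def)
  then show "(z - block_centre z) \<bullet> h = 0"
    by (simp add: h inner_stack inner_centre)
qed

section \<open>Spectrum and decay of the block system\<close>

context filtered_consensus
begin

definition system :: "real^('n + 'n)^('n + 'n)" where
  "system = block_matrix 0 (- Q) (\<omega> *\<^sub>R mat 1) (- (\<omega> *\<^sub>R mat 1))"

lemma system_stack: "system *v stack u v = stack (- (Q *v v)) (\<omega> *\<^sub>R (u - v))"
proof -
  have "- Q *v v = - (Q *v v)"
    using matrix_vector_mult_diff_rdistrib[of 0 Q v] by simp
  moreover have "- (\<omega> *\<^sub>R mat 1) *v v = - (\<omega> *\<^sub>R v)"
    using matrix_vector_mult_diff_rdistrib[of 0 "\<omega> *\<^sub>R mat 1" v]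
    by (simp add: scaleR_matrix_vector_assoc[symmetric])
  ultimately show ?thesis
    unfolding system_def block_matrix_mult_stack
    by (simp add: stack_eq_iff scaleR_diff_right scaleR_matrix_vector_assoc[symmetric])
qed

lemma Q_vec: "Q *v vec c = 0"
proof -
  have "vec c = c *\<^sub>R (1 :: real^'n)"
    by (simp add: vec_eq_iff)
  then show ?thesis
    by (simp add: matrix_vector_mult_scaleR Q_one)
qed

lemma Q_centre: "Q *v centre u = Q *v u"
  by (simp add: centre_def matrix_vector_mult_diff_distrib Q_vec)

lemma Q_kernel:
  assumes "Q *v u = 0"
  shows "\<exists>c. u = vec c"
proof -
  have "centre u = 0"
    using GQ_pos[OF centre_H1[of u]] assms by (auto simp: Q_centre)
  then show ?thesis by (rule centre_eq_0D)
qed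

text \<open>\<open>Q\<close> annihilates constants and maps into \<open>H1\<close>, so centring
  before or after the system matrix is the same. Centred solutions therefore solve the same
  system.\<close>

lemma block_centre_system: "block_centre (system *v z) = system *v block_centre z"
proof -
  obtain u v where "z = stack u v" by (metis stack_blocks)
  then show ?thesis
    using Q_H1 by (simp add: system_stack Q_centre centre_id linear_neg[OF linear_centre]
        linear_scale[OF linear_centre] linear_diff[OF linear_centre])
qed

text \<open>A kernel vector has \<open>Q *v v = 0\<close> and \<open>u = v\<close>, hence is
  constant. The vector \<open>1\<close> is not in the range, since the upper block of any image has
  zero mean.\<close>

lemma simple_zero: "simple_eigenvalue system 0" and finite_eigenvalues: "finite (eigenvalues system)"
proof -
  have one: "system *v 1 = 0"
    using Q_one by (simp add: system_stack stack_linear flip: stack_vec[of 1] vec_1)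
  have ker: "\<exists>c. z = vec c" if "system *v z = 0" for z
  proof -
    obtain u v where z: "z = stack u v" by (metis stack_blocks)
    have "stack (- (Q *v v)) (\<omega> *\<^sub>R (u - v)) = stack 0 0"
      using that by (simp add: z system_stack stack_linear)
    then have "Q *v v = 0" "u = v"
      using \<omega>_pos by (simp_all add: stack_eq_iff)
    then show ?thesis
      using Q_kernel[of v] z stack_vec by metis
  qed
  have range: "system *v z \<noteq> 1" for z
  proof
    assume *: "system *v z = 1"
    obtain u v where z: "z = stack u v" by (metis stack_blocks)
    have "stack (- (Q *v v)) (\<omega> *\<^sub>R (u - v)) = stack (vec 1) (vec 1)"
      using * unfolding z system_stack stack_vec by simp
    then have "- (Q *v v) = vec 1"
      by (simp add: stack_eq_iff)
    moreover have "- (Q *v v) \<in> H1"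
      by (simp add: Q_H1 subspace_neg[OF subspace_H1])
    ultimately show False
      using vec_in_H1_iff[of 1, where 'n='n] by simp
  qed
  show "simple_eigenvalue system 0" "finite (eigenvalues system)"
    using simple_zero_eigenvalue[OF one ker range] by auto
qed

text \<open>In the variables \<open>v\<close> and \<open>p = u - v / 2\<close> the system reads \<open>v' = \<omega> p - \<omega> v / 2\<close>,
  \<open>\<omega> p' = - \<omega>\<^sup>2 p / 2 - K v\<close> with \<open>K = \<omega> Q - \<omega>\<^sup>2 / 4\<close>.  The energy
  \<open>\<omega>\<^sup>2 p \<bullet> G p + v \<bullet> G (K + 2 c\<^sup>2) v\<close> is chosen so that the terms containing \<open>K\<close> cancel in
  its derivative, which leaves \<open>4 c\<^sup>2 \<omega> (v \<bullet> G p)\<close> besides the decay at rate \<open>\<omega>\<close>.\<close>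

lemma system_exp_estimate:
  assumes \<mu>: "\<And>x. x \<in> H1 \<Longrightarrow> \<mu> * (x \<bullet> (G *v x)) \<le> x \<bullet> (G *v (Q *v x))"
    and c: "c \<ge> 0" "0 \<le> \<omega> * \<mu> - \<omega>\<^sup>2 / 4 + c\<^sup>2" "0 < \<omega> * \<mu> - \<omega>\<^sup>2 / 4 + 2 * c\<^sup>2"
  shows "exp_estimate system H1_times_H1 (\<omega> / 2 - c)"
proof -
  define g h where "g x y = x \<bullet> (G *v y)" and "h x y = x \<bullet> (G *v (Q *v y))" for x y
  \<comment> \<open>Coefficient of \<open>G\<close> in \<open>K + 2 * c\<^sup>2\<close> once
    \<open>\<omega> * Q\<close> is split off; \<open>\<delta>\<close> below is the resulting lower
    bound for that form relative to \<open>G\<close>.\<close>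
  define e where "e = 2 * c\<^sup>2 - \<omega>\<^sup>2 / 4"
  define \<delta> where "\<delta> = \<omega> * \<mu> - \<omega>\<^sup>2 / 4 + 2 * c\<^sup>2"
  define p where "p z = upper_block z - (1 / 2) *\<^sub>R lower_block z" for z :: "real^('n + 'n)"
  define B where "B z z' = \<omega>\<^sup>2 * g (p z) (p z') + \<omega> * h (lower_block z) (lower_block z')
    + e * g (lower_block z) (lower_block z')" for z z'
  have g_sym: "g x y = g y x" and h_sym: "h x y = h y x" for x y
    using G_sym GQ_sym by (auto simp: g_def h_def)
  have g_lin: "g x (y + z) = g x y + g x z" "g x (y - z) = g x y - g x z" "g x (r *\<^sub>R y) = r * g x y"
      "g x (- y) = - g x y" for x y z r
    unfolding g_def using linear_neg[of "(*v) G" y]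
    by (simp_all add: matrix_vector_right_distrib matrix_vector_mult_diff_distrib
        matrix_vector_mult_scaleR inner_add_right inner_diff_right)
  have h_lin: "h x (y + z) = h x y + h x z" "h x (y - z) = h x y - h x z" "h x (r *\<^sub>R y) = r * h x y" for x y z r
    unfolding h_def
    by (simp_all add: matrix_vector_right_distrib matrix_vector_mult_diff_distrib
        matrix_vector_mult_scaleR inner_add_right inner_diff_right)
  have p_lin: "p (y + z) = p y + p z" "p (r *\<^sub>R y) = r *\<^sub>R p y" for y z r
    by (simp_all add: p_def blocks_linear algebra_simps)
  have B_sym: "B x y = B y x" for x y
    unfolding B_def using g_sym h_sym by simp
  have "linear (B x)" for x
    by (rule linearI)
       (simp_all add: B_def p_lin blocks_linear g_lin h_lin algebra_simps)
  then have "bounded_bilinear B"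
    using B_sym by (simp add: bilinear_def flip: bilinear_conv_bounded_bilinear)
  \<comment> \<open>The quotient of \<open>G\<close> against the identity provides
    \<open>m > 0\<close> with \<open>m * (x \<bullet> x) \<le> g x x\<close> on \<open>H1\<close>,
    which makes the energy coercive.\<close>
  obtain m y where y: "y \<in> H1" "y \<noteq> 0" "\<And>x. x \<in> H1 \<Longrightarrow> m * (x \<bullet> x) \<le> g x x"
      "\<And>x. x \<in> H1 \<Longrightarrow> x \<bullet> (G *v y - m *\<^sub>R y) = 0"
  proof (rule rayleigh_minimum[of "(*v) G" "\<lambda>x. x" H1])
    show "linear (\<lambda>x :: real^'n. x)"
      by (rule linear_ident)
    show "x \<bullet> y = y \<bullet> x" for x y :: "real^'n"
      by (rule inner_commute)
    show "x \<bullet> (G *v y) = y \<bullet> (G *v x)" for x y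
      by (rule G_sym)
  qed (use subspace_H1 H1_nontrivial[OF card] in \<open>auto simp: g_def\<close>)
  have "m * (y \<bullet> y) > 0"
    using y(4)[OF y(1)] G_pos[OF y(1,2)] by (simp add: inner_diff_right)
  then have m: "m > 0"
    using inner_ge_zero[of y] by (simp add: zero_less_mult_iff)
  have g_nonneg: "g x x \<ge> 0" if "x \<in> H1" for x
    using G_pos[OF that] by (cases "x = 0") (auto simp: g_def less_imp_le)
  have h_lower: "\<delta> * g v v \<le> \<omega> * h v v + e * g v v" if "v \<in> H1" for v
    using mult_left_mono[OF \<mu>[OF that], of \<omega>] \<omega>_pos
    by (simp add: \<delta>_def e_def g_def h_def algebra_simps)
  have p_H1: "p (stack u v) \<in> H1" if "u \<in> H1" "v \<in> H1" for u v
    unfolding p_def block_stack using that by (intro subspace_diff subspace_scale subspace_H1)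
  define \<alpha> where "\<alpha> = m * min (\<omega>\<^sup>2) \<delta> / 2"
  have "\<delta> > 0"
    using c by (simp add: \<delta>_def)
  then have "\<alpha> > 0"
    using m \<omega>_pos by (simp add: \<alpha>_def)
  have lower: "\<alpha> * (norm (stack u v))\<^sup>2 \<le> B (stack u v) (stack u v)" if uv: "u \<in> H1" "v \<in> H1" for u v
  proof -
    define q where "q = p (stack u v)"
    have u: "u = q + (1 / 2) *\<^sub>R v"
      by (simp add: q_def p_def)
    have "0 \<le> (q - (1 / 2) *\<^sub>R v) \<bullet> (q - (1 / 2) *\<^sub>R v)"
      by simp
    then have "u \<bullet> u + v \<bullet> v \<le> 2 * (q \<bullet> q) + 3 / 2 * (v \<bullet> v)"
      unfolding u by (simp add: inner_add_left inner_add_right inner_diff_left inner_diff_right inner_commute)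
    also have "\<dots> \<le> 2 * (q \<bullet> q + v \<bullet> v)"
      by simp
    finally have "\<alpha> * (u \<bullet> u + v \<bullet> v) \<le> \<alpha> * (2 * (q \<bullet> q + v \<bullet> v))"
      using \<open>\<alpha> > 0\<close> by (intro mult_left_mono) auto
    also have "\<dots> = min (\<omega>\<^sup>2) \<delta> * (m * (q \<bullet> q)) + min (\<omega>\<^sup>2) \<delta> * (m * (v \<bullet> v))"
      by (simp add: \<alpha>_def algebra_simps)
    also have "\<dots> \<le> \<omega>\<^sup>2 * g q q + \<delta> * g v v"
      using y(3)[of q] y(3)[of v] p_H1[OF uv] uv m \<open>\<delta> > 0\<close>
      by (intro add_mono mult_mono) (auto simp: q_def)
    also have "\<dots> \<le> B (stack u v) (stack u v)"
      using h_lower[OF uv(2)] by (simp add: B_def q_def)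
    finally show ?thesis
      by (simp add: power2_norm_eq_inner inner_stack)
  qed
  have decay: "B (stack u v) (system *v stack u v) \<le> - (\<omega> / 2 - c) * B (stack u v) (stack u v)"
    if uv: "u \<in> H1" "v \<in> H1" for u v
  proof -
    define q where "q = p (stack u v)"
    have q: "q \<in> H1"
      unfolding q_def using uv by (rule p_H1)
    have u: "u = q + (1 / 2) *\<^sub>R v"
      by (simp add: q_def p_def)
    have Bvv: "B (stack u v) (stack u v) = \<omega>\<^sup>2 * g q q + \<omega> * h v v + e * g v v"
      by (simp add: B_def q_def)
    have low': "\<omega> *\<^sub>R (u - v) = \<omega> *\<^sub>R q - (\<omega> / 2) *\<^sub>R v"
      by (simp add: u vec_eq_iff algebra_simps)
    have p': "p (system *v stack u v) = - (Q *v v) - (\<omega> / 2) *\<^sub>R q + (\<omega> / 4) *\<^sub>R v"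
      unfolding system_stack p_def block_stack low' by (simp add: vec_eq_iff algebra_simps)
    have gQ: "g x (Q *v y) = h x y" for x y
      by (simp add: g_def h_def)
    have "B (stack u v) (system *v stack u v) = \<omega>\<^sup>2 * (- h q v - \<omega> / 2 * g q q + \<omega> / 4 * g q v)
        + \<omega> * (\<omega> * h v q - \<omega> / 2 * h v v) + e * (\<omega> * g v q - \<omega> / 2 * g v v)"
      unfolding B_def p' unfolding system_stack block_stack low' q_def[symmetric]
      by (simp add: g_lin h_lin gQ)
    also have "\<dots> = - (\<omega> / 2) * (\<omega>\<^sup>2 * g q q + \<omega> * h v v + e * g v v) + c * (2 * c * \<omega> * g v q)"
      unfolding h_sym[of q v] g_sym[of q v] e_def by (simp add: algebra_simps power2_eq_square)
    finally have 1: "B (stack u v) (system *v stack u v)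
        = - (\<omega> / 2) * B (stack u v) (stack u v) + c * (2 * c * \<omega> * g v q)"
      unfolding Bvv .
    \<comment> \<open>Completing the square bounds the cross term by the energy;
      \<open>c\<^sup>2 \<le> \<delta>\<close> is the second assumption on \<open>c\<close>.\<close>
    have "0 \<le> g (\<omega> *\<^sub>R q - c *\<^sub>R v) (\<omega> *\<^sub>R q - c *\<^sub>R v)"
      using q uv by (intro g_nonneg subspace_diff subspace_scale subspace_H1)
    also have "\<dots> = \<omega>\<^sup>2 * g q q - 2 * c * \<omega> * g v q + c\<^sup>2 * g v v"
      unfolding g_lin g_sym[of "\<omega> *\<^sub>R q - c *\<^sub>R v"]
      using g_sym[of q v] by (simp add: algebra_simps power2_eq_square)
    finally have "2 * c * \<omega> * g v q \<le> \<omega>\<^sup>2 * g q q + c\<^sup>2 * g v v"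
      by simp
    moreover have "c\<^sup>2 * g v v \<le> \<delta> * g v v"
      using c(2) g_nonneg[OF uv(2)] by (intro mult_right_mono) (auto simp: \<delta>_def)
    ultimately have "2 * c * \<omega> * g v q \<le> B (stack u v) (stack u v)"
      using h_lower[OF uv(2)] unfolding Bvv by linarith
    then have "c * (2 * c * \<omega> * g v q) \<le> c * B (stack u v) (stack u v)"
      using c(1) by (rule mult_left_mono)
    then show ?thesis
      unfolding 1 by (simp add: algebra_simps)
  qed
  show ?thesis
    by (rule exp_estimate_lyapunov[OF \<open>bounded_bilinear B\<close> B_sym linear_block_centre
          block_centre_system orth_proj_H1_times_H1 \<open>\<alpha> > 0\<close>])
       (auto simp: block_centre_def intro!: lower decay[simplified] centre_H1)
qed

text \<open>An eigenvector with nonzero centred part is covered by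
  \<open>exp_estimate_imp_le\<close>. Otherwise both blocks are constant; there the system has only
  the eigenvalues \<open>0\<close> and \<open>- \<omega>\<close>, whence the condition
  \<open>\<eta> \<le> \<omega>\<close>.\<close>

lemma Re_eigenvalue_le:
  assumes est: "exp_estimate system H1_times_H1 \<eta>" "\<eta> \<le> \<omega>" and z: "z \<in> eigenvalues system" "z \<noteq> 0"
  shows "Re z \<le> - \<eta>"
proof -
  obtain a b where nz: "a \<noteq> 0 \<or> b \<noteq> 0" and a: "system *v a = Re z *\<^sub>R a - Im z *\<^sub>R b"
      and b: "system *v b = Im z *\<^sub>R a + Re z *\<^sub>R b"
    using z(1) by (auto simp: eigenvalues_iff_real_pair)
  show ?thesis
  proof (cases "block_centre a \<noteq> 0 \<or> block_centre b \<noteq> 0")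
    case True
    show ?thesis
      by (rule exp_estimate_imp_le[OF est(1) linear_block_centre orth_proj_H1_times_H1 a b True])
  next
    case False
    have vecs: "\<exists>r t. x = stack (vec r) (vec t)" if "block_centre x = 0" for x :: "real^('n + 'n)"
    proof -
      have "stack (centre (upper_block x)) (centre (lower_block x)) = stack 0 0"
        using that by (simp add: block_centre_def stack_linear)
      then have "\<exists>r. upper_block x = vec r" "\<exists>t. lower_block x = vec t"
        by (auto simp: stack_eq_iff intro: centre_eq_0D)
      then show ?thesis
        by (metis stack_blocks)
    qed
    obtain r t r' t' where a': "a = stack (vec r) (vec t)" and b': "b = stack (vec r') (vec t')"
      using False vecs by meson
    have comb: "k *\<^sub>R stack (vec x :: real^'n) (vec x' :: real^'n) + l *\<^sub>R stack (vec y) (vec y')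
        = stack (vec (k * x + l * y)) (vec (k * x' + l * y'))" for k l x y x' y' :: real
      by (simp add: vec_eq_iff stack_def split: sum.split)
    have sys: "system *v stack (vec x) (vec y) = stack (vec 0) (vec (\<omega> * (x - y)))" for x y
      by (simp add: system_stack Q_vec stack_eq_iff) (simp add: vec_eq_iff)
    have vec_inj: "vec x = (vec y :: real^'n) \<longleftrightarrow> x = y" for x y :: real
      by (simp add: vec_eq_iff)
    have comb': "k *\<^sub>R stack (vec x :: real^'n) (vec x' :: real^'n) - l *\<^sub>R stack (vec y) (vec y')
        = stack (vec (k * x - l * y)) (vec (k * x' - l * y'))" for k l x y x' y' :: real
      by (simp add: vec_eq_iff stack_def split: sum.split)
    have r: "0 = Re z * r - Im z * r'" "\<omega> * (r - t) = Re z * t - Im z * t'"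
      using a unfolding a' b' sys comb' stack_eq_iff vec_inj by auto
    have r': "0 = Im z * r + Re z * r'" "\<omega> * (r' - t') = Im z * t + Re z * t'"
      using b unfolding a' b' sys comb stack_eq_iff vec_inj by auto
    \<comment> \<open>In complex terms, \<open>(k + i l) (x + i y) = 0\<close> with a nonzero first
      factor.\<close>
    have sq: "x = 0 \<and> y = 0" if "0 = k * x - l * y" "0 = l * x + k * y" "k \<noteq> 0 \<or> l \<noteq> 0" for k l x y :: real
    proof -
      have "(k\<^sup>2 + l\<^sup>2) * x = k * (k * x - l * y) + l * (l * x + k * y)"
        "(k\<^sup>2 + l\<^sup>2) * y = k * (l * x + k * y) - l * (k * x - l * y)"
        by (simp_all add: algebra_simps power2_eq_square)
      then show ?thesis
        using that(3) unfolding that(1,2)[symmetric] by (auto simp: sum_power2_eq_zero_iff)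
    qed
    have "r = 0 \<and> r' = 0"
      using r(1) r'(1) z(2) by (intro sq) (auto simp: complex_eq_iff)
    then have r0: "r = 0" "r' = 0" by auto
    have "Re z + \<omega> = 0"
    proof (rule ccontr)
      assume "Re z + \<omega> \<noteq> 0"
      then have "t = 0 \<and> t' = 0"
        using r(2) r'(2) r0 by (intro sq[of "Re z + \<omega>" _ "Im z"]) (auto simp: algebra_simps)
      then show False
        using nz r0 by (auto simp: a' b' stack_linear(4))
    qed
    then show ?thesis
      using est(2) by simp
  qed
qed

text \<open>An eigenvalue \<open>\<mu>\<close> of \<open>Q\<close> gives the roots of
  \<open>z^2 + \<omega> z + \<omega> \<mu>\<close> as eigenvalues of the system. For the least
  Rayleigh quotient, the slower root meets the bound of the energy estimate, so
  \<open>\<eta>\<close> equals \<open>\<eta>0\<close>.\<close>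

lemma convergence:
  defines "\<eta> \<equiv> - Max (Re ` (eigenvalues system - {0}))"
  shows "globally_exp_stable_on system H1_times_H1"
    and "convergence_rate system H1_times_H1 \<eta>"
    and "(\<forall>z \<in> eigenvalues system - {0}. Re z = - \<eta> \<longrightarrow> semisimple_eigenvalue system z)
      \<Longrightarrow> exp_estimate system H1_times_H1 \<eta>"
proof -
  obtain \<mu> x where x: "x \<in> H1" "x \<noteq> 0"
    and \<mu>: "\<And>x. x \<in> H1 \<Longrightarrow> \<mu> * (x \<bullet> (G *v x)) \<le> x \<bullet> (G *v (Q *v x))"
    and x': "\<And>y. y \<in> H1 \<Longrightarrow> y \<bullet> (G *v (Q *v x) - \<mu> *\<^sub>R (G *v x)) = 0"
  proof (rule rayleigh_minimum[of "\<lambda>x. G *v (Q *v x)" "(*v) G" H1])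
    show "linear (\<lambda>x. G *v (Q *v x))"
      by (simp add: matrix_vector_mul_assoc)
  qed (use subspace_H1 H1_nontrivial[OF card] in \<open>auto intro: G_pos GQ_sym G_sym\<close>)
  \<comment> \<open>Stationarity is known only against \<open>H1\<close>, but the residual
    \<open>w\<close> lies there, so \<open>w \<bullet> (G *v w) = 0\<close> forces
    \<open>w = 0\<close>.\<close>
  define w where "w = Q *v x - \<mu> *\<^sub>R x"
  have "w \<in> H1"
    unfolding w_def using x Q_H1 by (intro subspace_diff subspace_scale subspace_H1)
  moreover have "w \<bullet> (G *v w) = 0"
    using x'[OF \<open>w \<in> H1\<close>]
    by (simp add: w_def matrix_vector_mult_diff_distrib matrix_vector_mult_scaleR)
  ultimately have "w = 0"
    using G_pos by fastforce
  then have Qx: "Q *v x = \<mu> *\<^sub>R x"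
    by (simp add: w_def)
  have "0 < \<mu> * (x \<bullet> (G *v x))"
    using GQ_pos[OF x] by (simp add: Qx matrix_vector_mult_scaleR)
  then have "\<mu> > 0"
    using G_pos[OF x] by (simp add: zero_less_mult_iff)
  \<comment> \<open>A quarter of the discriminant of
    \<open>z^2 + \<omega> z + \<omega> \<mu>\<close>. At most one of \<open>c\<close> and
    \<open>\<tau>\<close> is nonzero, so \<open>- \<omega> / 2 + c + i \<tau>\<close> is a root of
    largest real part whether the roots are real or not.\<close>
  define disc where "disc = \<omega>\<^sup>2 / 4 - \<omega> * \<mu>"
  define c where "c = sqrt (max 0 disc)"
  define \<tau> where "\<tau> = sqrt (max 0 (- disc))"
  define \<eta>0 where "\<eta>0 = \<omega> / 2 - c"
  have c0: "c \<ge> 0"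
    by (simp add: c_def)
  have c_sq: "c\<^sup>2 = max 0 disc"
    by (simp add: c_def)
  have "c < \<omega> / 2"
  proof -
    have "max 0 disc < (\<omega> / 2)\<^sup>2"
      using mult_pos_pos[OF \<omega>_pos \<open>\<mu> > 0\<close>] \<omega>_pos by (auto simp: disc_def power_divide max_def)
    then show ?thesis
      unfolding c_def using \<omega>_pos by (intro real_less_lsqrt) auto
  qed
  then have \<eta>0: "\<eta>0 > 0" "\<eta>0 \<le> \<omega>"
    using c0 \<omega>_pos by (auto simp: \<eta>0_def)
  \<comment> \<open>Strict slack \<open>c' > c\<close> meets both conditions of the energy estimate
    even when \<open>disc = 0\<close>.\<close>
  have below: "exp_estimate system H1_times_H1 \<eta>'" if "\<eta>' < \<eta>0" for \<eta>'
  proof -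
    define c' where "c' = \<omega> / 2 - \<eta>'"
    have c': "c' > c" "c' > 0"
      using that c0 by (auto simp: c'_def \<eta>0_def)
    have sq: "c'\<^sup>2 > max 0 disc"
      using c0 c' unfolding c_sq[symmetric] by (intro power_strict_mono) auto
    have "exp_estimate system H1_times_H1 (\<omega> / 2 - c')"
    proof (rule system_exp_estimate[OF \<mu>])
      show "0 \<le> \<omega> * \<mu> - \<omega>\<^sup>2 / 4 + c'\<^sup>2" "0 < \<omega> * \<mu> - \<omega>\<^sup>2 / 4 + 2 * c'\<^sup>2"
        using sq unfolding disc_def by linarith+
    qed (use c' in auto)
    then show ?thesis by (simp add: c'_def)
  qed
  have upper: "Re z \<le> - \<eta>0" if "z \<in> eigenvalues system - {0}" for z
  proof (rule ccontr)
    assume "\<not> Re z \<le> - \<eta>0"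
    then obtain \<eta>' where "- Re z < \<eta>'" "\<eta>' < \<eta>0"
      using dense[of "- Re z" \<eta>0] by auto
    then show False
      using Re_eigenvalue_le[OF below[of \<eta>'], of z] \<eta>0 that by auto
  qed
  define lam where "lam = Complex (- \<eta>0) \<tau>"
  \<comment> \<open>Real and imaginary parts of the quadratic equation at
    \<open>- \<eta>0 + i \<tau>\<close>.\<close>
  have char: "(- \<eta>0) * (- \<eta>0) + (- \<eta>0) * \<omega> - \<tau> * \<tau> = - (\<omega> * \<mu>)" "\<tau> * (\<omega> - 2 * \<eta>0) = 0"
  proof -
    have "\<tau> * \<tau> = max 0 (- disc)" "c * c = max 0 disc"
      by (simp_all add: \<tau>_def c_def)
    then show "(- \<eta>0) * (- \<eta>0) + (- \<eta>0) * \<omega> - \<tau> * \<tau> = - (\<omega> * \<mu>)"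
      by (simp add: \<eta>0_def algebra_simps) (simp add: disc_def power2_eq_square max_def split: if_splits)
    show "\<tau> * (\<omega> - 2 * \<eta>0) = 0"
      by (auto simp: \<eta>0_def \<tau>_def c_def max_def)
  qed
  have "lam \<in> eigenvalues system"
    unfolding eigenvalues_iff_real_pair
  proof (intro exI conjI)
    \<comment> \<open>Real and imaginary parts of the eigenvector with blocks
      \<open>(lam + \<omega>) x\<close> and \<open>\<omega> x\<close>.\<close>
    let ?a = "stack ((\<omega> - \<eta>0) *\<^sub>R x) (\<omega> *\<^sub>R x)" and ?b = "stack (\<tau> *\<^sub>R x) (0 *\<^sub>R x)"
    have comb: "k *\<^sub>R stack (r *\<^sub>R x) (t *\<^sub>R x) + l *\<^sub>R stack (r' *\<^sub>R x) (t' *\<^sub>R x)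
        = stack ((k * r + l * r') *\<^sub>R x) ((k * t + l * t') *\<^sub>R x)" for k l r t r' t'
      by (simp add: vec_eq_iff stack_def algebra_simps split: sum.split)
    have comb': "k *\<^sub>R stack (r *\<^sub>R x) (t *\<^sub>R x) - l *\<^sub>R stack (r' *\<^sub>R x) (t' *\<^sub>R x)
        = stack ((k * r - l * r') *\<^sub>R x) ((k * t - l * t') *\<^sub>R x)" for k l r t r' t'
      by (simp add: vec_eq_iff stack_def algebra_simps split: sum.split)
    have sys: "system *v stack (r *\<^sub>R x) (t *\<^sub>R x) = stack (- (t * \<mu>) *\<^sub>R x) ((\<omega> * (r - t)) *\<^sub>R x)" for r t
      by (simp add: system_stack matrix_vector_mult_scaleR Qx stack_eq_iff algebra_simps)
    show "?a \<noteq> 0 \<or> ?b \<noteq> 0"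
      using x(2) \<omega>_pos by (metis block_stack(2) scaleR_eq_0_iff stack_linear(4) less_irrefl)
    show "system *v ?a = Re lam *\<^sub>R ?a - Im lam *\<^sub>R ?b"
      unfolding sys comb' using char
      by (intro arg_cong2[where f = stack] arg_cong2[where f = scaleR] refl)
         (simp_all add: lam_def algebra_simps)
    show "system *v ?b = Im lam *\<^sub>R ?a + Re lam *\<^sub>R ?b"
      unfolding sys comb using char
      by (intro arg_cong2[where f = stack] arg_cong2[where f = scaleR] refl)
         (auto simp: lam_def algebra_simps)
  qed
  moreover have "lam \<noteq> 0"
    using \<eta>0 by (simp add: lam_def complex_eq_iff)
  ultimately have lam: "lam \<in> eigenvalues system - {0}" "Re lam = - \<eta>0"
    by (simp_all add: lam_def)
  have "Max (Re ` (eigenvalues system - {0})) = - \<eta>0"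
    using upper lam finite_eigenvalues by (intro Max_eqI) (auto intro!: image_eqI[of _ _ lam])
  then have \<eta>: "\<eta> = \<eta>0"
    by (simp add: \<eta>_def)
  show "globally_exp_stable_on system H1_times_H1"
    unfolding globally_exp_stable_on_def using subspace_H1_times_H1 below[of "\<eta>0 / 2"] \<eta>0
    by (intro conjI exI[of _ "\<eta>0 / 2"]) auto
  show "convergence_rate system H1_times_H1 \<eta>"
    unfolding convergence_rate_def \<eta>
  proof (rule isLubI2)
    show "isUb UNIV {\<eta>'. \<eta>' > 0 \<and> exp_estimate system H1_times_H1 \<eta>'} \<eta>0"
    proof (intro isUbI setleI ballI)
      fix \<eta>' assume "\<eta>' \<in> {\<eta>'. \<eta>' > 0 \<and> exp_estimate system H1_times_H1 \<eta>'}"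
      then have est: "exp_estimate system H1_times_H1 \<eta>'" by simp
      \<comment> \<open>Capping at \<open>\<omega>\<close> makes \<open>Re_eigenvalue_le\<close>
        applicable; as \<open>\<eta>0 < \<omega>\<close>, the minimum must be
        \<open>\<eta>'\<close>.\<close>
      have "Re lam \<le> - min \<eta>' \<omega>"
        using lam by (intro Re_eigenvalue_le exp_estimate_mono[OF est]) auto
      then show "\<eta>' \<le> \<eta>0"
        using lam(2) c0 \<omega>_pos by (auto simp: \<eta>0_def min_def split: if_splits)
    qed simp
    show "\<eta>0 <=* Collect (isUb UNIV {\<eta>'. \<eta>' > 0 \<and> exp_estimate system H1_times_H1 \<eta>'})"
    proof (intro setgeI ballI)
      fix b assume "b \<in> Collect (isUb UNIV {\<eta>'. \<eta>' > 0 \<and> exp_estimate system H1_times_H1 \<eta>'})"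
      then have b: "\<eta>' \<le> b" if "0 < \<eta>'" "\<eta>' < \<eta>0" for \<eta>'
        using that below by (auto dest: isUbD)
      show "\<eta>0 \<le> b"
        using b by (rule dense_le_bounded[OF \<eta>0(1)])
    qed
  qed
  show "exp_estimate system H1_times_H1 \<eta>"
    if semi: "\<forall>z \<in> eigenvalues system - {0}. Re z = - \<eta> \<longrightarrow> semisimple_eigenvalue system z"
  proof (cases "disc = 0")
    case True
    then have "c = 0" "\<omega> * \<mu> = \<omega>\<^sup>2 / 4" "\<tau> = 0"
      by (auto simp: c_def disc_def \<tau>_def)
    then have \<eta>0': "\<eta>0 = \<omega> / 2" and \<mu>': "\<mu> = \<omega> / 4" and lam': "lam = of_real (- \<omega> / 2)"
      using \<omega>_pos by (auto simp: \<eta>0_def power2_eq_square lam_def complex_eq_iff)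
    \<comment> \<open>At the double root \<open>- \<omega> / 2\<close>, \<open>stack x 0\<close> is
      a generalised eigenvector above the eigenvector, contradicting \<open>semi\<close>.\<close>
    have "\<not> semisimple_eigenvalue system (of_real (- \<omega> / 2))"
    proof (rule not_semisimple_eigenvalueI)
      show "system *v stack x 0 = (- \<omega> / 2) *\<^sub>R stack x 0 + stack ((\<omega> / 2) *\<^sub>R x) (\<omega> *\<^sub>R x)"
        unfolding system_stack by (simp add: vec_eq_iff stack_def split: sum.split)
      show "system *v stack ((\<omega> / 2) *\<^sub>R x) (\<omega> *\<^sub>R x) = (- \<omega> / 2) *\<^sub>R stack ((\<omega> / 2) *\<^sub>R x) (\<omega> *\<^sub>R x)"
        unfolding system_stack matrix_vector_mult_scaleR Qx \<mu>'
        by (simp add: vec_eq_iff stack_def algebra_simps split: sum.split)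
      show "stack ((\<omega> / 2) *\<^sub>R x) (\<omega> *\<^sub>R x) \<noteq> 0"
        using x(2) \<omega>_pos by (metis block_stack(2) scaleR_eq_0_iff stack_linear(4) less_irrefl)
    qed
    then show ?thesis
      using semi lam by (metis \<eta> lam')
  next
    case False
    \<comment> \<open>For \<open>disc < 0\<close> one has \<open>c = 0\<close>, and for
      \<open>disc > 0\<close> one has \<open>c\<^sup>2 = disc\<close>; either way the exponent
      \<open>\<eta>0\<close> itself is admissible.\<close>
    then have "0 \<le> - disc + c\<^sup>2" "0 < - disc + 2 * c\<^sup>2"
      unfolding c_sq by (auto simp: max_def)
    then show ?thesis
      unfolding \<eta> \<eta>0_def disc_def using c0 by (intro system_exp_estimate[OF \<mu>]) auto
  qed
qed

end

theorem theorem2: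
  fixes E\<^sub>c F\<^sub>c E\<^sub>e\<^sub>l :: "('n::finite \<times> 'n) set"
    and a w :: "'n \<Rightarrow> 'n \<Rightarrow> real"
    and d :: "'n \<Rightarrow> real"
    and k\<^sub>I \<omega>\<^sub>c :: real
    and L D M Q \<Omega> :: "real^'n^'n"
    and \<Q> :: "real^('n + 'n)^('n + 'n)"
  assumes N: "CARD('n) \<ge> 2"
    and "connected_weighted_graph E\<^sub>c a"
    and "orientation_of F\<^sub>c E\<^sub>c"
    and "k\<^sub>I > 0"
    and L: "L = k\<^sub>I *\<^sub>R laplacian F\<^sub>c a"
    and "weakly_connected_weighted_digraph E\<^sub>e\<^sub>l w"
    and M: "M = laplacian E\<^sub>e\<^sub>l w"
    and "\<And>i. d i > 0"
    and D: "D = diag_matrix d"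
    and "\<omega>\<^sub>c > 0"
    and \<Omega>: "\<Omega> = \<omega>\<^sub>c *\<^sub>R mat 1"
    and Q: "Q = L ** D ** M"
    and \<Q>: "\<Q> = block_matrix 0 (- Q) \<Omega> (- \<Omega>)"
    and AB: "D = mat 1 \<or> (D \<noteq> mat 1 \<and> L ** D ** M = M ** D ** L)"
  shows "globally_exp_stable_on \<Q> H1_times_H1
    \<and> simple_eigenvalue \<Q> 0
    \<and> (let \<eta> = - Max (Re ` (eigenvalues \<Q> - {0})) in
         convergence_rate \<Q> H1_times_H1 \<eta>
         \<and> ((\<forall>z \<in> eigenvalues \<Q> - {0}. Re z = - \<eta> \<longrightarrow> semisimple_eigenvalue \<Q> z)
              \<longrightarrow> exp_estimate \<Q> H1_times_H1 \<eta>))"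
proof -
  have L_cons: "consensus_matrix L"
    unfolding L using assms(2-4)
    by (intro consensus_matrix_scaleR consensus_matrix_laplacian weakly_connected_orientation)
  have M_cons: "consensus_matrix M"
    unfolding M by (rule consensus_matrix_laplacian) fact
  \<comment> \<open>The cases differ only in the witness: \<open>M\<close> for
    \<open>D = mat 1\<close>, and \<open>mat 1\<close> in the commuting case.\<close>
  have "\<exists>G. filtered_consensus Q G \<omega>\<^sub>c"
    using AB
  proof
    assume "D = mat 1"
    then show ?thesis
      using filtered_consensus_unscaled[OF N \<open>\<omega>\<^sub>c > 0\<close> L_cons M_cons] by (auto simp: Q)
  next
    assume "D \<noteq> mat 1 \<and> L ** D ** M = M ** D ** L"
    then show ?thesis
      using filtered_consensus_commuting[where d = d, OF N \<open>\<omega>\<^sub>c > 0\<close> L_cons M_cons \<open>\<And>i. d i > 0\<close>]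
      unfolding Q D by blast
  qed
  then obtain G where "filtered_consensus Q G \<omega>\<^sub>c" ..
  then interpret filtered_consensus Q G \<omega>\<^sub>c .
  have "\<Q> = system"
    by (simp add: \<Q> \<Omega> system_def)
  then show ?thesis
    using simple_zero convergence unfolding Let_def by blast
qed

end
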